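(* The exclusive minors (E-minors) of $n\times n$ matrices are fixed points under the action of $SL(2)^{\times n}$. In particular, the exclusive rank (E-rank) is invariant under $G\simeq SL(2)^{\times n}\ltimes\mathfrak{S}_n$.
   Context: All matrices are $n\times n$ with complex entries. An exclusive minor (E-minor) of a matrix $A$ is a minor whose row index set $I$ and column index set $J$ satisfy $I\cap J=\emptyset$. The exclusive rank (E-rank) of $A$ is the minimal $k$ such that all the $(k+1)\times(k+1)$ E-minors of $A$ vanish. The action is the following. Let $V=E\oplus F$ with $E\simeq F\simeq\mathbb{C}^n$, with bases $e_1,\dots,e_n$ of $E$ and $f_1,\dots,f_n$ of $F$. Sending a matrix to the vector of all its minors parametrizes (an open part of) the Grassmannian $G(n,V)\subset\mathbb{P}(\bigwedge^n V)$; after choosing a volume form on $E$, the element $e_R\wedge f_S$ of $\bigwedge^{n-k}E\wedge\bigwedge^k F$ (with $|R|=n-k$, $|S|=k$) represents the minor of $A$ with rows indexed by the complement $R^c$ and columns indexed by $S$. The group $GL(V)=GL(2n)$ acts on $\bigwedge^n V$ and on $G(n,V)$, hence on vectors of minors. The group $SL(2)^{\times n}$ acts through its inclusion in $GL(2n)$ as the block matrices $\begin{pmatrix} D_1 & D_2\\ D_3 & D_4\end{pmatrix}$ with each $D_i$ a diagonal $n\times n$ matrix and $D_1D_4-D_2D_3=I_n$, the $i$-th copy of $SL(2)$ acting on the span of $e_i,f_i$. The symmetric group $\mathfrak{S}_n$ acts by permuting the indices $1,\dots,n$ simultaneously for the $e_i$ and the $f_i$.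
   Formalization: An E-minor with rows I, columns J is claimed fixed only by the SL(2) copies indexed by I∪J (by all of SL(2)^n if I∪J is everything); the other copies move it, e.g. diag(2,1/2) in the third copy doubles the (1,2) entry for n=3. E-rank invariance under G is in full. *)

theory Defs
  imports
    "HOL-Combinatorics.Permutations"
    "Jordan_Normal_Form.Determinant"
    "Jordan_Normal_Form.DL_Submatrix"
begin

text \<open>The indices \<open>1, \<dots>, n\<close> are represented by \<open>0, \<dots>, n - 1\<close>.\<close>

definition minor :: "complex mat \<Rightarrow> nat set \<Rightarrow> nat set \<Rightarrow> complex" where
  "minor A I J = det (submatrix A I J)"

definition E_indices :: "nat \<Rightarrow> nat \<Rightarrow> (nat set \<times> nat set) set" where
  "E_indices n k = {(I, J). I \<subseteq> {0..<n} \<and> J \<subseteq> {0..<n} \<and> card I = k \<and> card J = k \<and> I \<inter> J = {}}"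

definition E_rank :: "complex mat \<Rightarrow> nat" where
  "E_rank A = (LEAST k. \<forall>(I, J) \<in> E_indices (dim_row A) (k + 1). minor A I J = 0)"

text \<open>
  An element of the \<open>m\<close>-th exterior power of \<open>\<complex>\<^sup>N\<close> is represented by its coordinates with respect to
  the basis \<open>v\<^sub>T = v\<^bsub>t1\<^esub> \<and> \<dots> \<and> v\<^bsub>tm\<^esub>\<close>, where \<open>T = {t1 < \<dots> < tm}\<close> ranges over the \<open>m\<close>-subsets of
  \<open>{0..<N}\<close>; the coordinate function is \<open>0\<close> on all other sets.
\<close>

type_synonym ext = "nat set \<Rightarrow> complex"

definition ksubsets :: "nat \<Rightarrow> nat \<Rightarrow> nat set set" where
  "ksubsets N m = {T. T \<subseteq> {0..<N} \<and> card T = m}"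

definition wedge :: "nat \<Rightarrow> complex vec list \<Rightarrow> ext" where
  "wedge N vs = (\<lambda>T. if T \<in> ksubsets N (length vs)
     then det (mat (length vs) (length vs) (\<lambda>(i, j). (vs ! j) $ (sorted_list_of_set T ! i)))
     else 0)"

text \<open>
  The action of \<open>g \<in> GL(N)\<close> is the linear extension of
  \<open>v\<^bsub>u1\<^esub> \<and> \<dots> \<and> v\<^bsub>um\<^esub> \<mapsto> g v\<^bsub>u1\<^esub> \<and> \<dots> \<and> g v\<^bsub>um\<^esub>\<close>.
\<close>

definition ext_act :: "nat \<Rightarrow> nat \<Rightarrow> complex mat \<Rightarrow> ext \<Rightarrow> ext" where
  "ext_act N m g x = (\<lambda>T. \<Sum>U \<in> ksubsets N m.
     x U * wedge N (map (\<lambda>u. g *\<^sub>v unit_vec N u) (sorted_list_of_set U)) T)"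

text \<open>\<open>V = E \<oplus> F = \<complex>\<^bsup>2n\<^esup>\<close>, with the basis of \<open>E\<close> first.\<close>

definition e_vec :: "nat \<Rightarrow> nat \<Rightarrow> complex vec" where
  "e_vec n i = unit_vec (2 * n) i"

definition f_vec :: "nat \<Rightarrow> nat \<Rightarrow> complex vec" where
  "f_vec n i = unit_vec (2 * n) (n + i)"

definition ef_wedge :: "nat \<Rightarrow> nat set \<Rightarrow> nat set \<Rightarrow> ext" where
  "ef_wedge n R S = wedge (2 * n)
     (map (e_vec n) (sorted_list_of_set R) @ map (f_vec n) (sorted_list_of_set S))"

definition minor_vec :: "nat \<Rightarrow> nat set \<Rightarrow> nat set \<Rightarrow> ext" where
  "minor_vec n I J = ef_wedge n ({0..<n} - I) J"

text \<open>
  The vector of all minors of \<open>A\<close>: the Pluecker vector of the span of the rows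
  \<open>e\<^sub>i + (\<Sum>j. a\<^sub>i\<^sub>j f\<^sub>j)\<close> of \<open>(1 | A)\<close>.  Its coordinate at \<open>e\<^sub>R \<and> f\<^sub>S\<close> is, up to a sign depending only
  on \<open>R\<close> and \<open>S\<close>, the minor of \<open>A\<close> with rows \<open>{0..<n} - R\<close> and columns \<open>S\<close>.
\<close>

definition minors_of :: "nat \<Rightarrow> complex mat \<Rightarrow> ext" where
  "minors_of n A = wedge (2 * n) (map (\<lambda>i. unit_vec n i @\<^sub>v row A i) [0..<n])"

definition SL2_power :: "nat \<Rightarrow> complex mat set" where
  "SL2_power n = {four_block_mat D1 D2 D3 D4 | D1 D2 D3 D4.
     D1 \<in> carrier_mat n n \<and> D2 \<in> carrier_mat n n \<and> D3 \<in> carrier_mat n n \<and> D4 \<in> carrier_mat n n \<and>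
     diagonal_mat D1 \<and> diagonal_mat D2 \<and> diagonal_mat D3 \<and> diagonal_mat D4 \<and>
     D1 * D4 - D2 * D3 = 1\<^sub>m n}"

text \<open>The product of the copies of \<open>SL(2)\<close> with index in \<open>K\<close>; the other copies act trivially.\<close>

definition SL2_power_on :: "nat \<Rightarrow> nat set \<Rightarrow> complex mat set" where
  "SL2_power_on n K = {g \<in> SL2_power n. \<forall>i < n. i \<notin> K \<longrightarrow>
     g *\<^sub>v e_vec n i = e_vec n i \<and> g *\<^sub>v f_vec n i = f_vec n i}"

text \<open>\<open>\<sigma>\<close> acts by \<open>e\<^sub>i \<mapsto> e\<^bsub>\<sigma> i\<^esub>\<close> and \<open>f\<^sub>i \<mapsto> f\<^bsub>\<sigma> i\<^esub>\<close>.\<close>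

definition perm_mat :: "nat \<Rightarrow> (nat \<Rightarrow> nat) \<Rightarrow> complex mat" where
  "perm_mat n \<sigma> = mat n n (\<lambda>(i, j). if i = \<sigma> j then 1 else 0)"

definition Sym_group :: "nat \<Rightarrow> complex mat set" where
  "Sym_group n = {four_block_mat (perm_mat n \<sigma>) (0\<^sub>m n n) (0\<^sub>m n n) (perm_mat n \<sigma>) | \<sigma>.
     \<sigma> permutes {0..<n}}"

text \<open>\<open>Sym_group n\<close> normalises \<open>SL2_power n\<close>, so this is their (internal) semidirect product.\<close>

definition G_group :: "nat \<Rightarrow> complex mat set" where
  "G_group n = {g * h | g h. g \<in> SL2_power n \<and> h \<in> Sym_group n}"

text \<open>
  The action on matrices is only partially defined: the image under \<open>g\<close> of the point of the
  Grassmannian given by \<open>A\<close> need not be the point of a matrix.  The vectors of minors are compared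
  in the projective space.
\<close>

definition moves :: "nat \<Rightarrow> complex mat \<Rightarrow> complex mat \<Rightarrow> complex mat \<Rightarrow> bool" where
  "moves n g A B \<longleftrightarrow> A \<in> carrier_mat n n \<and> B \<in> carrier_mat n n \<and>
     (\<exists>c. c \<noteq> 0 \<and> ext_act (2 * n) n g (minors_of n A) = (\<lambda>T. c * minors_of n B T))"

text \<open>
  An E-minor with \<open>I \<union> J \<noteq> {0..<n}\<close> is not fixed by the copies of \<open>SL(2)\<close> whose index lies outside
  \<open>I \<union> J\<close>, since then \<open>e\<^sub>i\<close> occurs in \<open>e\<^sub>R \<and> f\<^sub>S\<close> while \<open>f\<^sub>i\<close> does not.  Here the entry of a
  3 by 3 matrix in row 0 and column 1 is multiplied by 2 under \<open>diag(2, 1/2)\<close> in the last copy.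
\<close>

lemma E_minor_not_fixed:
  "({0}, {1}) \<in> E_indices 3 1 \<and>
   (\<exists>g \<in> SL2_power 3. ext_act 6 3 g (minor_vec 3 {0} {1}) \<noteq> minor_vec 3 {0} {1})"
proof -
  define d :: "nat \<Rightarrow> complex" where "d = (\<lambda>i. if i = 2 then 2 else if i = 5 then 1/2 else 1)"
  define D1 where "D1 = mat 3 3 (\<lambda>(i,j). if i = j then d i else 0)"
  define D4 where "D4 = mat 3 3 (\<lambda>(i,j). if i = j then d (3 + i) else 0)"
  define g where "g = four_block_mat D1 (0\<^sub>m 3 3) (0\<^sub>m 3 3) D4"
  have "D1 * D4 - 0\<^sub>m 3 3 * 0\<^sub>m 3 3 = 1\<^sub>m 3"
    by (rule eq_matI) (auto simp: D1_def D4_def d_def scalar_prod_def numeral_3_eq_3 less_Suc_eq)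
  then have g: "g \<in> SL2_power 3"
    unfolding SL2_power_def g_def
    by (intro CollectI exI[of _ D1] exI[of _ "0\<^sub>m 3 3"] exI[of _ D4])
       (auto simp: diagonal_mat_def D1_def D4_def)
  have g_idx: "g $$ (i, j) = (if i = j then d i else 0)" if "i < 6" "j < 6" for i j
    using that unfolding g_def D1_def D4_def by (auto simp: index_mat_four_block)
  have gdim: "g \<in> carrier_mat 6 6"
  proof -
    have "D1 \<in> carrier_mat 3 3" "D4 \<in> carrier_mat 3 3" by (simp_all add: D1_def D4_def)
    from four_block_carrier_mat[OF this, of "0\<^sub>m 3 3" "0\<^sub>m 3 3"] show ?thesis by (simp add: g_def)
  qed
  have g_unit: "(g *\<^sub>v unit_vec 6 u) $ i = (if i = u then d u else 0)" if "i < 6" "u < 6" for i u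
  proof -
    have "(g *\<^sub>v unit_vec 6 u) $ i = row g i \<bullet> unit_vec 6 u" using that gdim by simp
    also have "\<dots> = row g i $ u" using that gdim by (intro scalar_prod_right_unit) auto
    also have "\<dots> = g $$ (i, u)" using that gdim by simp
    also have "\<dots> = (if i = u then d u else 0)" using that by (simp add: g_idx)
    finally show ?thesis .
  qed
  define T :: "nat set" where "T = {1, 2, 4}"
  have T: "T \<in> ksubsets 6 3" by (auto simp: T_def ksubsets_def)
  have sT: "sorted_list_of_set T = [1, 2, 4]" by (simp add: T_def)
  have fin: "finite (ksubsets 6 3)" by (auto simp: ksubsets_def)
  have det1: "wedge 6 (map (\<lambda>u. g *\<^sub>v unit_vec 6 u) (sorted_list_of_set U)) T = (if U = T then 2 else 0)"
    if U: "U \<in> ksubsets 6 3" for U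
  proof -
    have fU: "finite U" and cU: "card U = 3" and sub: "U \<subseteq> {0..<6}"
      using U by (auto simp: ksubsets_def intro: finite_subset)
    define l where "l = sorted_list_of_set U"
    have l: "length l = 3" "set l = U" using fU cU by (auto simp: l_def)
    define M where "M = mat 3 3 (\<lambda>(i, j). (map (\<lambda>u. g *\<^sub>v unit_vec 6 u) l ! j) $ ([1::nat, 2, 4] ! i))"
    have w: "wedge 6 (map (\<lambda>u. g *\<^sub>v unit_vec 6 u) l) T = det M"
      using T l sT by (simp add: wedge_def M_def)
    have lt: "[1::nat, 2, 4] ! i < 6" if "i < 3" for i
      using that by (auto simp: numeral_3_eq_3 less_Suc_eq)
    have lj: "l ! j < 6" if "j < 3" for j
      using that l sub nth_mem[of j l] by auto
    have Mij: "M $$ (i, j) = (if [1::nat, 2, 4] ! i = l ! j then d (l ! j) else 0)" if "i < 3" "j < 3" for i j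
      using that l lt[of i] lj[of j] by (simp add: M_def g_unit del: index_mult_mat_vec)
    have M: "M \<in> carrier_mat 3 3" by (simp add: M_def)
    show ?thesis
    proof (cases "U = T")
      case True
      then have l3: "l = [1, 2, 4]" using sT by (simp add: l_def)
      have "upper_triangular M"
        using M by (auto simp: upper_triangular_def Mij l3 numeral_3_eq_3 less_Suc_eq)
      then have "det M = prod_list (diag_mat M)" using M by (rule det_upper_triangular)
      also have "\<dots> = 2"
        using M by (simp add: diag_mat_def Mij l3 d_def numeral_3_eq_3)
      finally show ?thesis using True w by (simp add: l_def)
    next
      case False
      have "\<not> U \<subseteq> T" using False cU card_subset_eq[of T U] by (auto simp: T_def)
      then obtain u where u: "u \<in> U" "u \<notin> T" by auto
      then obtain j where j: "j < 3" "l ! j = u" using l by (metis in_set_conv_nth)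
      have "M $$ (i, j) = 0" if "i < 3" for i
        using that j u by (auto simp: Mij T_def numeral_3_eq_3 less_Suc_eq)
      then have "det M = 0" using laplace_expansion_column[OF M j(1)] by simp
      then show ?thesis using False w by (simp add: l_def)
    qed
  qed
  have R: "{0..<3} - {0} = {1, 2 :: nat}" by auto
  have wT: "minor_vec 3 {0} {1} T = 1"
  proof -
    define M :: "complex mat" where "M = mat 3 3 (\<lambda>(i, j). [unit_vec 6 1, unit_vec 6 2, unit_vec 6 4] ! j $ ([1::nat, 2, 4] ! i))"
    have "minor_vec 3 {0} {1} T = det M"
      using T by (simp add: minor_vec_def ef_wedge_def wedge_def R sT e_vec_def f_vec_def M_def numeral_3_eq_3[symmetric])
    also have "M = 1\<^sub>m 3"
      by (rule eq_matI) (auto simp: M_def numeral_3_eq_3 less_Suc_eq)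
    finally show ?thesis by simp
  qed
  have "ext_act 6 3 g (minor_vec 3 {0} {1}) T = (\<Sum>U \<in> ksubsets 6 3. if U = T then 2 * minor_vec 3 {0} {1} U else 0)"
    unfolding ext_act_def by (intro sum.cong) (auto simp: det1)
  also have "\<dots> = 2" using T fin wT by simp
  finally have "ext_act 6 3 g (minor_vec 3 {0} {1}) \<noteq> minor_vec 3 {0} {1}" using wT by auto
  with g show ?thesis by (auto simp: E_indices_def)
qed

end

theory Submission
  imports Defs
begin

text \<open>
  In coordinates, \<open>g\<close> acts on the exterior power by the minors \<open>det g[T, U]\<close>.  A matrix in
  \<open>SL(2)\<^sup>n\<close> only mixes \<open>e\<^sub>i\<close> with \<open>f\<^sub>i\<close>, so if \<open>T\<close> contains both or none of \<open>e\<^sub>i, f\<^sub>i\<close> for every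
  \<open>i\<close> on which \<open>g\<close> acts, then row \<open>T\<close> and column \<open>T\<close> of the matrix of these minors are those of the identity.
  This gives the invariance of the E-minors.

  For the E-rank, note that an E-minor on \<open>(I, J)\<close> is carried to combinations of the minors on
  \<open>(I \<union> K, J \<union> K)\<close> with \<open>K\<close> disjoint from \<open>I\<close> and \<open>J\<close>.  These are not E-minors, but by Laplace
  expansion along the rows in \<open>I\<close> they vanish as soon as all E-minors of size \<open>|I|\<close> do.  Hence the
  vanishing of all E-minors of size \<open>k\<close> says that all coordinates at sets \<open>T\<close> containing at least
  \<open>k\<close> full pairs \<open>{e\<^sub>i, f\<^sub>i}\<close> vanish.  The number of full pairs is preserved by the action of the group;
  the converse implication uses the inverse of \<open>g\<close>, and Cauchy--Binet for the functoriality of the action.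
\<close>

subsection \<open>Minors indexed by lists\<close>

text \<open>Lists instead of index sets allow reordered, concatenated and repeated indices;
  repetitions occur in the proof of Cauchy--Binet. Sorted lists give back
  \<open>minor\<close>.\<close>

definition select_mat :: "'a mat \<Rightarrow> nat list \<Rightarrow> nat list \<Rightarrow> 'a mat" where
  "select_mat A xs ys = mat (length xs) (length ys) (\<lambda>(i, j). A $$ (xs ! i, ys ! j))"

lemma select_mat_carrier [simp]:
  "length xs = m \<Longrightarrow> length ys = k \<Longrightarrow> select_mat A xs ys \<in> carrier_mat m k"
  by (auto simp: select_mat_def)

lemma dim_select_mat [simp]:
  "dim_row (select_mat A xs ys) = length xs" "dim_col (select_mat A xs ys) = length ys"
  by (simp_all add: select_mat_def)

lemma index_select_mat [simp]:
  "i < length xs \<Longrightarrow> j < length ys \<Longrightarrow> select_mat A xs ys $$ (i, j) = A $$ (xs ! i, ys ! j)"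
  by (simp add: select_mat_def)

lemma transpose_select_mat:
  assumes "set xs \<subseteq> {..<dim_row A}" "set ys \<subseteq> {..<dim_col A}"
  shows "transpose_mat (select_mat A xs ys) = select_mat (transpose_mat A) ys xs"
proof (rule eq_matI)
  fix i j
  assume "i < dim_row (select_mat (transpose_mat A) ys xs)"
    "j < dim_col (select_mat (transpose_mat A) ys xs)"
  then have "i < length ys" "j < length xs" by simp_all
  moreover from this have "ys ! i < dim_col A" "xs ! j < dim_row A"
    using assms by (meson lessThan_iff nth_mem subsetD)+
  ultimately show "transpose_mat (select_mat A xs ys) $$ (i, j) = select_mat (transpose_mat A) ys xs $$ (i, j)"
   by simp
qed simp_all

lemma det_select_mat_transpose:
  fixes A :: "'a :: comm_ring_1 mat"
  assumes "set xs \<subseteq> {..<dim_row A}" "set ys \<subseteq> {..<dim_col A}" "length xs = length ys"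
  shows "det (select_mat (transpose_mat A) ys xs) = det (select_mat A xs ys)"
proof -
  have "select_mat A xs ys \<in> carrier_mat (length xs) (length xs)"
    using assms(3) by simp
  from det_transpose[OF this] show ?thesis
    unfolding transpose_select_mat[OF assms(1,2)] .
qed

lemma det_select_mat_permute_rows:
  fixes A :: "'a :: comm_ring_1 mat"
  assumes p: "p permutes {..<length xs}" and "length ys = length xs"
  shows "det (select_mat A (permute_list p xs) ys) = signof p * det (select_mat A xs ys)"
proof -
  have "p i < length xs" if "i < length xs" for i
    using permutes_in_image[OF p, of i] that by simp
  then have "select_mat A (permute_list p xs) ys =
      mat (length xs) (length xs) (\<lambda>(i, j). select_mat A xs ys $$ (p i, j))"
    using assms by (intro eq_matI) (auto simp: permute_list_nth)
  then show ?thesis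
    using det_permute_rows[of "select_mat A xs ys" "length xs" p] assms
    by (simp add: lessThan_atLeast0)
qed

lemma det_select_mat_permute_cols:
  fixes A :: "'a :: comm_ring_1 mat"
  assumes p: "p permutes {..<length xs}" and l: "length ys = length xs"
  shows "det (select_mat A ys (permute_list p xs)) = signof p * det (select_mat A ys xs)"
proof -
  let ?m = "length xs"
  have plt: "p i < ?m" if "i < ?m" for i
    using permutes_in_image[OF p, of i] that by simp
  have car: "select_mat A ys zs \<in> carrier_mat ?m ?m" if "length zs = ?m" for zs
    using that l by simp
  have "det (select_mat A ys (permute_list p xs)) =
      det (transpose_mat (select_mat A ys (permute_list p xs)))"
    by (rule det_transpose[symmetric, OF car]) simp
  also have "transpose_mat (select_mat A ys (permute_list p xs)) =
      mat ?m ?m (\<lambda>(i, j). transpose_mat (select_mat A ys xs) $$ (p i, j))"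
    using plt assms by (intro eq_matI) (auto simp: permute_list_nth)
  also have "det \<dots> = signof p * det (transpose_mat (select_mat A ys xs))"
    using car[OF refl] p by (intro det_permute_rows) (auto simp: lessThan_atLeast0)
  also have "det (transpose_mat (select_mat A ys xs)) = det (select_mat A ys xs)"
    by (rule det_transpose[OF car]) simp
  finally show ?thesis .
qed

text \<open>\<open>s\<close> is the sign of the permutation between the two orderings. It is fixed
  before \<open>A\<close> and \<open>ys\<close>, so one sign serves rows and columns and all
  matrices.\<close>

lemma det_select_mat_reorder:
  assumes "distinct xs" "distinct xs'" "set xs' = set xs"
  obtains s :: "'a :: comm_ring_1" where "s * s = 1"
    "\<And>A ys. length ys = length xs \<Longrightarrow> det (select_mat A xs' ys) = s * det (select_mat A xs ys)"
    "\<And>A ys. length ys = length xs \<Longrightarrow> det (select_mat A ys xs') = s * det (select_mat A ys xs)"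
proof -
  have "mset xs' = mset xs" using assms set_eq_iff_mset_eq_distinct by blast
  then obtain p where p: "p permutes {..<length xs}" "permute_list p xs = xs'"
    by (rule mset_eq_permutation)
  have "(signof p :: 'a) * signof p = 1" by (simp add: sign_def)
  then show ?thesis
  proof (rule that)
    fix A :: "'a mat" and ys :: "nat list"
    assume "length ys = length xs"
    with p show "det (select_mat A xs' ys) = signof p * det (select_mat A xs ys)"
      "det (select_mat A ys xs') = signof p * det (select_mat A ys xs)"
      using det_select_mat_permute_rows[of p xs ys A] det_select_mat_permute_cols[of p xs ys A]
      by simp_all
  qed
qed

text \<open>Some Leibniz term is nonzero, and its permutation, carried from positions to list
  entries, is the bijection. This turns the zero pattern of a matrix into the vanishing of its
  minors.\<close>

lemma bij_of_det_select_mat_nonzero: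
  fixes A :: "'a :: idom mat"
  assumes nz: "det (select_mat A xs ys) \<noteq> 0"
    and "length xs = length ys" "distinct xs" "distinct ys"
  obtains f where "bij_betw f (set xs) (set ys)" "\<And>x. x \<in> set xs \<Longrightarrow> A $$ (x, f x) \<noteq> 0"
proof -
  let ?m = "length xs"
  have "det (select_mat A xs ys) =
      (\<Sum>p | p permutes {0..<?m}. signof p * (\<Prod>i = 0..<?m. select_mat A xs ys $$ (i, p i)))"
    using assms(2) by (simp add: det_def)
  with nz obtain p where p: "p permutes {0..<?m}"
    and pz: "(\<Prod>i = 0..<?m. select_mat A xs ys $$ (i, p i)) \<noteq> 0"
    using sum.not_neutral_contains_not_neutral[of
        "\<lambda>p. signof p * (\<Prod>i = 0..<?m. select_mat A xs ys $$ (i, p i))" "{p. p permutes {0..<?m}}"]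
    by (metis mem_Collect_eq mult_zero_right)
  have p_lt: "p i < ?m" if "i < ?m" for i using permutes_in_image[OF p, of i] that by simp
  define ix where "ix = the_inv_into {..<?m} ((!) xs)"
  have bx: "bij_betw ((!) xs) {..<?m} (set xs)" using assms(3) by (simp add: bij_betw_nth)
  have "bij_betw ix (set xs) {..<?m}"
    unfolding ix_def using bx by (rule bij_betw_the_inv_into)
  moreover have "bij_betw p {..<?m} {..<?m}"
    using permutes_imp_bij[OF p] by (simp add: lessThan_atLeast0)
  moreover have "bij_betw ((!) ys) {..<?m} (set ys)" using assms(2,4) by (simp add: bij_betw_nth)
  ultimately have "bij_betw ((!) ys \<circ> (p \<circ> ix)) (set xs) (set ys)"
    by (blast intro: bij_betw_trans)
  moreover have "A $$ (x, ((!) ys \<circ> (p \<circ> ix)) x) \<noteq> 0" if x: "x \<in> set xs" for x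
  proof -
    obtain i where i: "i < ?m" "x = xs ! i" using x by (auto simp: in_set_conv_nth)
    then have "ix x = i"
      unfolding ix_def using bx by (simp add: the_inv_into_f_f bij_betw_def)
    moreover have "select_mat A xs ys $$ (i, p i) \<noteq> 0" using pz i by simp
    ultimately show ?thesis using i p_lt[of i] assms(2) by simp
  qed
  ultimately show ?thesis by (rule that)
qed

text \<open>
  Instead of the general Laplace expansion: average the Leibniz formula over the permutations of the
  rows \<open>xs\<close>, so that the inner sums become the minors assumed to vanish.
\<close>

lemma det_rows_vanish:
  fixes A :: "'a :: {idom, ring_char_0} mat"
  assumes len: "length zs = length (xs @ ys)" and "distinct zs"
    and vanish: "\<And>us. distinct us \<Longrightarrow> set us \<subseteq> set zs \<Longrightarrow> length us = length xs \<Longrightarrow>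
      det (select_mat A xs us) = 0"
  shows "det (select_mat A (xs @ ys) zs) = 0"
proof -
  let ?k = "length xs" and ?m = "length (xs @ ys)"
  let ?Q = "{q. q permutes {..<?k}}" and ?P = "{p. p permutes {0..<?m}}"
  let ?a = "\<lambda>i j. A $$ ((xs @ ys) ! i, zs ! j)"
  \<comment> \<open>As a permutation of all row positions, \<open>q\<close> fixes those of
    \<open>ys\<close>, and its sign is unchanged.\<close>
  have det_eq: "det (select_mat A (permute_list q xs @ ys) zs) =
      signof q * det (select_mat A (xs @ ys) zs)" if q: "q permutes {..<?k}" for q
  proof -
    have q': "q permutes {..<?m}" using q by (rule permutes_subset) auto
    have "permute_list q (xs @ ys) = permute_list q xs @ ys"
    proof (rule nth_equalityI)
      fix i assume "i < length (permute_list q (xs @ ys))"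
      then show "permute_list q (xs @ ys) ! i = (permute_list q xs @ ys) ! i"
        using permutes_in_image[OF q, of i] permutes_not_in[OF q, of i] q q'
        by (auto simp: permute_list_nth nth_append)
    qed simp
    then show ?thesis using det_select_mat_permute_rows[OF q', of zs A] len by simp
  qed
  have part: "det (select_mat A (permute_list q xs @ ys) zs) =
      (\<Sum>p\<in>?P. signof p * ((\<Prod>i<?k. A $$ (xs ! q i, zs ! p i)) * (\<Prod>i = ?k..<?m. ?a i (p i))))"
    if q: "q permutes {..<?k}" for q
  proof -
    have "(\<Prod>i = 0..<?m. select_mat A (permute_list q xs @ ys) zs $$ (i, p i)) =
        (\<Prod>i<?k. A $$ (xs ! q i, zs ! p i)) * (\<Prod>i = ?k..<?m. ?a i (p i))"
      if p: "p permutes {0..<?m}" for p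
    proof -
      have plt: "p i < length zs" if "i < ?m" for i using permutes_in_image[OF p, of i] that len by simp
      have "(\<Prod>i = 0..<?m. select_mat A (permute_list q xs @ ys) zs $$ (i, p i)) =
          (\<Prod>i = 0..<?k. select_mat A (permute_list q xs @ ys) zs $$ (i, p i)) *
          (\<Prod>i = ?k..<?m. select_mat A (permute_list q xs @ ys) zs $$ (i, p i))"
        by (rule prod.atLeastLessThan_concat[symmetric]) auto
      also have "(\<Prod>i = 0..<?k. select_mat A (permute_list q xs @ ys) zs $$ (i, p i)) =
          (\<Prod>i<?k. A $$ (xs ! q i, zs ! p i))"
        using q plt by (intro prod.cong) (auto simp: nth_append permute_list_nth)
      also have "(\<Prod>i = ?k..<?m. select_mat A (permute_list q xs @ ys) zs $$ (i, p i)) =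
          (\<Prod>i = ?k..<?m. ?a i (p i))"
        using plt by (intro prod.cong) (auto simp: nth_append)
      finally show ?thesis .
    qed
    then show ?thesis
      using len by (subst det_def'[of _ ?m]) (auto intro!: sum.cong)
  qed
  \<comment> \<open>For fixed \<open>p\<close>, let \<open>us\<close> be the columns that
    \<open>p\<close> assigns to the rows \<open>xs\<close>. The sum over \<open>q\<close> is then
    the column form of the Leibniz formula for the minor on \<open>xs\<close> and
    \<open>us\<close>.\<close>
  have inner: "(\<Sum>q\<in>?Q. signof q * (\<Prod>i<?k. A $$ (xs ! q i, zs ! p i))) = 0" if p: "p permutes {0..<?m}" for p
  proof -
    have plt: "p i < length zs" if "i < ?m" for i using permutes_in_image[OF p, of i] that len by simp
    define us where "us = map (\<lambda>i. zs ! p i) [0..<?k]"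
    have "inj_on (\<lambda>i. zs ! p i) {0..<?k}"
      using \<open>distinct zs\<close> plt permutes_inj[OF p]
      by (auto intro!: inj_onI simp: nth_eq_iff_index_eq inj_eq)
    then have us: "distinct us" "set us \<subseteq> set zs" "length us = ?k"
      using plt by (auto simp: us_def distinct_map)
    have "(\<Sum>q\<in>?Q. signof q * (\<Prod>i<?k. A $$ (xs ! q i, zs ! p i))) = det (select_mat A xs us)"
      using us
      by (subst det_col[of _ ?k])
         (auto simp: lessThan_atLeast0 us_def intro!: sum.cong prod.cong
            dest: permutes_in_image)
    then show ?thesis using vanish[OF us] by simp
  qed
  \<comment> \<open>The sign of \<open>q\<close> occurs twice and cancels, so every \<open>q\<close>
    contributes the same determinant. The factor \<open>fact ?k\<close> can be cancelled at the end
    because the characteristic is zero.\<close>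
  have "of_nat (fact ?k) * det (select_mat A (xs @ ys) zs) =
      (\<Sum>q\<in>?Q. signof q * (signof q * det (select_mat A (xs @ ys) zs)))"
  proof -
    have "signof q * (signof q * x) = (x :: 'a)" for q :: "nat \<Rightarrow> nat" and x
      by (simp add: sign_def)
    then show ?thesis using card_permutations[of "{..<?k}" ?k] by (simp only: sum_constant) simp
  qed
  also have "\<dots> = (\<Sum>q\<in>?Q. signof q * (\<Sum>p\<in>?P. signof p *
      ((\<Prod>i<?k. A $$ (xs ! q i, zs ! p i)) * (\<Prod>i = ?k..<?m. ?a i (p i)))))"
    by (intro sum.cong refl) (simp add: det_eq part flip: det_eq)
  also have "\<dots> = (\<Sum>p\<in>?P. signof p * (\<Prod>i = ?k..<?m. ?a i (p i)) *
      (\<Sum>q\<in>?Q. signof q * (\<Prod>i<?k. A $$ (xs ! q i, zs ! p i))))"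
    unfolding sum_distrib_left by (subst sum.swap) (simp add: ac_simps)
  also have "\<dots> = 0" by (intro sum.neutral ballI) (simp only: mem_Collect_eq inner mult_zero_right)
  finally show ?thesis by simp
qed

subsection \<open>The action on the exterior power\<close>

lemma finite_ksubsets [simp]: "finite (ksubsets N m)"
  by (simp add: ksubsets_def)

text \<open>Multilinearity in the rows of the product gives a sum over all maps \<open>f\<close>
  from row positions to \<open>{0..<N}\<close>. Maps that are not injective produce equal rows and
  drop out. The others are grouped by their image \<open>U\<close>; within a group they are the
  orderings of \<open>U\<close>, and their signs build the determinant of the \<open>G\<close>
  factor.\<close>

lemma cauchy_binet:
  fixes G H :: "'a :: comm_ring_1 mat"
  assumes G: "G \<in> carrier_mat nr N" and H: "H \<in> carrier_mat N nc"
    and xs: "set xs \<subseteq> {..<nr}" "length xs = m" and ys: "set ys \<subseteq> {..<nc}" "length ys = m"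
  shows "det (select_mat (G * H) xs ys) = (\<Sum>U\<in>ksubsets N m.
    det (select_mat G xs (sorted_list_of_set U)) * det (select_mat H (sorted_list_of_set U) ys))"
proof -
  define X where "X = select_mat G xs [0..<N]"
  define Y where "Y = select_mat H [0..<N] ys"
  have X: "X \<in> carrier_mat m N" and Y: "Y \<in> carrier_mat N m"
    using xs ys by (simp_all add: X_def Y_def)
  have xs_lt: "xs ! i < nr" if "i < m" for i using xs that nth_mem by fastforce
  have ys_lt: "ys ! i < nc" if "i < m" for i using ys that nth_mem by fastforce
  have XY: "select_mat (G * H) xs ys = X * Y"
    using X Y G H xs ys xs_lt ys_lt
    by (intro eq_matI) (auto simp: scalar_prod_def X_def Y_def)
  let ?M = "{0..<m}"
  \<comment> \<open>The identity outside \<open>?M\<close> is a default value that makes each map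
    occur exactly once.\<close>
  define F where "F = {f. (\<forall>i\<in>?M. f i \<in> {0..<N}) \<and> (\<forall>i. i \<notin> ?M \<longrightarrow> f i = i)}"
  define h where "h f = (\<Prod>i\<in>?M. G $$ (xs ! i, f i)) * det (select_mat H (map f [0..<m]) ys)" for f
  define Fi where "Fi = {f \<in> F. inj_on f ?M}"
  have finF: "finite F" unfolding F_def by (rule finite_bounded_functions) auto
  have det_row: "det (mat\<^sub>r m m (\<lambda>i. X $$ (i, f i) \<cdot>\<^sub>v row Y (f i))) = h f" if "f \<in> F" for f
  proof -
    have f: "f i < N" if "i < m" for i using that \<open>f \<in> F\<close> by (auto simp: F_def)
    have "det (mat\<^sub>r m m (\<lambda>i. X $$ (i, f i) \<cdot>\<^sub>v row Y (f i))) =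
        (\<Prod>i\<in>?M. X $$ (i, f i)) * det (mat\<^sub>r m m (\<lambda>i. row Y (f i)))"
      using Y by (intro det_rows_mul) auto
    also have "(\<Prod>i\<in>?M. X $$ (i, f i)) = (\<Prod>i\<in>?M. G $$ (xs ! i, f i))"
      using f xs by (intro prod.cong) (auto simp: X_def)
    also have "mat\<^sub>r m m (\<lambda>i. row Y (f i)) = select_mat H (map f [0..<m]) ys"
      using f ys by (intro eq_matI) (auto simp: Y_def)
    finally show ?thesis by (simp add: h_def)
  qed
  have h0: "h f = 0" if "f \<in> F - Fi" for f
  proof -
    obtain i j where ij: "i < m" "j < m" "i \<noteq> j" "f i = f j"
      using \<open>f \<in> F - Fi\<close> by (auto simp: Fi_def inj_on_def)
    have "row (select_mat H (map f [0..<m]) ys) i = row (select_mat H (map f [0..<m]) ys) j"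
      using ij ys by (intro eq_vecI) auto
    then have "det (select_mat H (map f [0..<m]) ys) = 0"
      using ij ys by (intro det_identical_rows[of _ m i j]) auto
    then show ?thesis by (simp add: h_def)
  qed
  have "det (select_mat (G * H) xs ys) = (\<Sum>f\<in>F. det (mat\<^sub>r m m (\<lambda>i. X $$ (i, f i) \<cdot>\<^sub>v row Y (f i))))"
    unfolding XY mat_mul_finsum_alt[OF X Y] F_def
    by (rule det_linear_rows_sum) (use Y in auto)
  also have "\<dots> = (\<Sum>f\<in>F. h f)" by (intro sum.cong refl det_row)
  also have "\<dots> = (\<Sum>f\<in>Fi. h f)"
    using finF h0 by (intro sum.mono_neutral_right) (auto simp: Fi_def)
  also have "\<dots> = (\<Sum>U\<in>ksubsets N m. \<Sum>f\<in>{f \<in> Fi. f ` ?M = U}. h f)"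
  proof (rule sum.group[symmetric])
    show "(\<lambda>f. f ` ?M) ` Fi \<subseteq> ksubsets N m"
      by (auto simp: Fi_def F_def ksubsets_def card_image)
    show "finite Fi" using finF by (simp add: Fi_def)
  qed simp
  also have "\<dots> = (\<Sum>U\<in>ksubsets N m.
    det (select_mat G xs (sorted_list_of_set U)) * det (select_mat H (sorted_list_of_set U) ys))"
  proof (rule sum.cong[OF refl])
    fix U assume U: "U \<in> ksubsets N m"
    then have finU: "finite U" by (auto simp: ksubsets_def intro: finite_subset)
    define us where "us = sorted_list_of_set U"
    have us: "distinct us" "set us = U" "length us = m"
      using U finU by (auto simp: us_def ksubsets_def)
    let ?P = "{p. p permutes ?M}"
    \<comment> \<open>\<open>\<Phi> p\<close> lists \<open>U\<close> in the order obtained from the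
      increasing one by \<open>p\<close>; outside \<open>?M\<close> it takes the default value
      required by \<open>F\<close>.\<close>
    define \<Phi> where "\<Phi> p = (\<lambda>i. if i < m then us ! p i else i)" for p :: "nat \<Rightarrow> nat"
    have p_lt: "p i < m" if "p permutes ?M" "i < m" for p i
      using permutes_in_image[OF that(1), of i] that(2) by simp
    have map_\<Phi>: "map (\<Phi> p) [0..<m] = permute_list p us" if "p permutes ?M" for p
      using that us by (intro nth_equalityI) (auto simp: \<Phi>_def permute_list_nth lessThan_atLeast0)
    have mem: "\<Phi> p \<in> {f \<in> Fi. f ` ?M = U}" if p: "p permutes ?M" for p
    proof -
      have "distinct (map (\<Phi> p) [0..<m])" "set (map (\<Phi> p) [0..<m]) = U"
        unfolding map_\<Phi>[OF p] using p us by (simp_all add: lessThan_atLeast0)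
      then have "inj_on (\<Phi> p) ?M" "\<Phi> p ` ?M = U" by (simp_all add: distinct_map)
      moreover from this have "\<Phi> p \<in> F"
        using U by (auto simp: F_def ksubsets_def \<Phi>_def)
      ultimately show ?thesis by (simp add: Fi_def)
    qed
    have "bij_betw \<Phi> ?P {f \<in> Fi. f ` ?M = U}"
      unfolding bij_betw_def
    proof
      show "inj_on \<Phi> ?P"
      proof (rule inj_onI)
        fix p q assume pq: "p \<in> ?P" "q \<in> ?P" "\<Phi> p = \<Phi> q"
        show "p = q"
        proof
          fix i
          show "p i = q i"
          proof (cases "i < m")
            case True
            then have "us ! p i = us ! q i" using fun_cong[OF pq(3), of i] by (simp add: \<Phi>_def)
            then show ?thesis using us p_lt pq True by (simp add: nth_eq_iff_index_eq)
          qed (use pq in \<open>auto simp: permutes_def\<close>)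
        qed
      qed
      show "\<Phi> ` ?P = {f \<in> Fi. f ` ?M = U}"
      proof (intro equalityI subsetI)
        fix f assume f: "f \<in> {f \<in> Fi. f ` ?M = U}"
        then have "mset (map f [0..<m]) = mset us"
          using us by (intro set_eq_iff_mset_eq_distinct[THEN iffD1]) (auto simp: distinct_map Fi_def)
        then obtain p where p: "p permutes {..<length us}" "permute_list p us = map f [0..<m]"
          by (rule mset_eq_permutation)
        then have p': "p permutes ?M" using us by (simp add: lessThan_atLeast0)
        have "map (\<Phi> p) [0..<m] = map f [0..<m]" using map_\<Phi>[OF p'] p by simp
        then have "\<Phi> p i = f i" for i
          using f by (cases "i < m") (auto simp: \<Phi>_def Fi_def F_def)
        then have "\<Phi> p = f" by (rule ext)
        then show "f \<in> \<Phi> ` ?P" using p' by blast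
      qed (use mem in auto)
    qed
    then have "(\<Sum>f\<in>{f \<in> Fi. f ` ?M = U}. h f) = (\<Sum>p\<in>?P. h (\<Phi> p))"
      by (rule sum.reindex_bij_betw[symmetric])
    also have "\<dots> = (\<Sum>p\<in>?P. (signof p * (\<Prod>i = 0..<m. select_mat G xs us $$ (i, p i))) *
        det (select_mat H us ys))"
    proof (rule sum.cong[OF refl])
      fix p assume "p \<in> ?P"
      then have p: "p permutes ?M" by simp
      have "(\<Prod>i\<in>?M. G $$ (xs ! i, \<Phi> p i)) = (\<Prod>i = 0..<m. select_mat G xs us $$ (i, p i))"
        using us xs p_lt[OF p] by (intro prod.cong) (auto simp: \<Phi>_def)
      moreover have "det (select_mat H (permute_list p us) ys) = signof p * det (select_mat H us ys)"
        using p us ys by (intro det_select_mat_permute_rows) (simp_all add: lessThan_atLeast0)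
      ultimately show "h (\<Phi> p) = (signof p * (\<Prod>i = 0..<m. select_mat G xs us $$ (i, p i))) *
          det (select_mat H us ys)"
        by (simp add: h_def map_\<Phi>[OF p])
    qed
    also have "\<dots> = det (select_mat G xs us) * det (select_mat H us ys)"
      using us xs by (subst det_def'[of "select_mat G xs us" m]) (auto simp: sum_distrib_right)
    finally show "(\<Sum>f\<in>{f \<in> Fi. f ` ?M = U}. h f) =
        det (select_mat G xs (sorted_list_of_set U)) * det (select_mat H (sorted_list_of_set U) ys)"
      by (simp add: us_def)
  qed
  finally show ?thesis .
qed

section \<open>Compound matrices and functoriality of the action\<close>

lemma ksubsetsD:
  assumes "U \<in> ksubsets N m"
  shows "finite U" "U \<subseteq> {..<N}" "card U = m"
  using assms by (auto simp: ksubsets_def intro: finite_subset)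

lemma ext_act_outside: "T \<notin> ksubsets N m \<Longrightarrow> ext_act N m g x T = 0"
  unfolding ext_act_def by (intro sum.neutral ballI) (simp add: wedge_def ksubsetsD)

lemma wedge_unit_vecs:
  assumes g: "g \<in> carrier_mat N N" and "T \<in> ksubsets N m" "length us = m" "set us \<subseteq> {..<N}"
  shows "wedge N (map (\<lambda>u. g *\<^sub>v unit_vec N u) us) T = det (select_mat g (sorted_list_of_set T) us)"
proof -
  note T = ksubsetsD[OF assms(2)]
  define ts where "ts = sorted_list_of_set T"
  have ts: "set ts = T" "length ts = m" using T by (simp_all add: ts_def)
  have "ts ! i < N" if "i < m" for i using ts T that nth_mem by fastforce
  moreover have "us ! j < N" if "j < m" for j using assms that nth_mem by fastforce
  moreover have "(g *\<^sub>v unit_vec N u) $ t = g $$ (t, u)" if "t < N" "u < N" for t u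
    using that g by (simp add: scalar_prod_right_unit)
  ultimately have "mat m m (\<lambda>(i, j). (map (\<lambda>u. g *\<^sub>v unit_vec N u) us ! j) $ (ts ! i)) = select_mat g ts us"
    using g ts assms(3) by (intro eq_matI) auto
  then show ?thesis using assms by (simp add: wedge_def ts_def)
qed

text \<open>In coordinates the action is the compound matrix of \<open>g\<close>, so wedges can be
  replaced by minors from here on.\<close>

lemma ext_act_eq:
  assumes "g \<in> carrier_mat N N" "T \<in> ksubsets N m"
  shows "ext_act N m g x T =
    (\<Sum>U\<in>ksubsets N m. x U * det (select_mat g (sorted_list_of_set T) (sorted_list_of_set U)))"
  unfolding ext_act_def
proof (rule sum.cong[OF refl])
  fix U assume "U \<in> ksubsets N m"
  from ksubsetsD[OF this]
  show "x U * wedge N (map (\<lambda>u. g *\<^sub>v unit_vec N u) (sorted_list_of_set U)) T =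
    x U * det (select_mat g (sorted_list_of_set T) (sorted_list_of_set U))"
    using wedge_unit_vecs[OF assms, of "sorted_list_of_set U"] by simp
qed

text \<open>Multiplicativity of compound matrices is Cauchy--Binet followed by an exchange of
  sums.\<close>

lemma ext_act_mult:
  assumes g: "g \<in> carrier_mat N N" and h: "h \<in> carrier_mat N N"
  shows "ext_act N m (g * h) x = ext_act N m g (ext_act N m h x)"
proof
  fix T
  let ?d = "\<lambda>g T U. det (select_mat g (sorted_list_of_set T) (sorted_list_of_set U))"
  let ?K = "ksubsets N m"
  show "ext_act N m (g * h) x T = ext_act N m g (ext_act N m h x) T"
  proof (cases "T \<in> ?K")
    case T: True
    have "ext_act N m (g * h) x T = (\<Sum>W\<in>?K. x W * (\<Sum>U\<in>?K. ?d g T U * ?d h U W))"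
      unfolding ext_act_eq[OF mult_carrier_mat[OF g h] T]
    proof (rule sum.cong[OF refl])
      fix W assume W: "W \<in> ?K"
      show "x W * ?d (g * h) T W = x W * (\<Sum>U\<in>?K. ?d g T U * ?d h U W)"
        using cauchy_binet[OF g h, of "sorted_list_of_set T" m "sorted_list_of_set W"]
          ksubsetsD[OF T] ksubsetsD[OF W] by simp
    qed
    also have "\<dots> = (\<Sum>U\<in>?K. (\<Sum>W\<in>?K. x W * ?d h U W) * ?d g T U)"
      unfolding sum_distrib_left sum_distrib_right by (subst sum.swap) (simp add: ac_simps)
    also have "\<dots> = ext_act N m g (ext_act N m h x) T"
      unfolding ext_act_eq[OF g T] by (intro sum.cong refl) (simp add: ext_act_eq[OF h])
    finally show ?thesis .
  qed (simp add: ext_act_outside)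
qed

text \<open>If the minor is nonzero, the resulting bijection from \<open>T\<close> to
  \<open>U\<close> fixes every element, since the identity has no entries off the diagonal; this
  forces \<open>U = T\<close>.\<close>

lemma det_select_mat_one:
  assumes T: "T \<in> ksubsets N m" and U: "U \<in> ksubsets N m"
  shows "det (select_mat (1\<^sub>m N) (sorted_list_of_set T) (sorted_list_of_set U)) =
    (if U = T then 1 else 0 :: complex)"
proof (cases "U = T")
  case True
  define ts where "ts = sorted_list_of_set T"
  have ts: "set ts = T" "distinct ts" using ksubsetsD[OF T] by (simp_all add: ts_def)
  have "ts ! i < N" if "i < length ts" for i using ts ksubsetsD[OF T] that nth_mem by fastforce
  then have "select_mat (1\<^sub>m N) ts ts = (1\<^sub>m (length ts) :: complex mat)"
    using ts by (intro eq_matI) (auto simp: nth_eq_iff_index_eq)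
  then show ?thesis using True by (simp add: ts_def)
next
  case False
  have "det (select_mat (1\<^sub>m N) (sorted_list_of_set T) (sorted_list_of_set U)) = (0 :: complex)"
  proof (rule ccontr)
    assume nz: "det (select_mat (1\<^sub>m N) (sorted_list_of_set T) (sorted_list_of_set U)) \<noteq> (0 :: complex)"
    obtain f where f: "bij_betw f T U" "\<And>t. t \<in> T \<Longrightarrow> 1\<^sub>m N $$ (t, f t) \<noteq> (0 :: complex)"
      using bij_of_det_select_mat_nonzero[OF nz] ksubsetsD[OF T] ksubsetsD[OF U] by auto
    have "f t = t" if "t \<in> T" for t
    proof -
      have "t < N" "f t < N" using that f(1) ksubsetsD[OF T] ksubsetsD[OF U] by (auto dest: bij_betwE)
      then show ?thesis using f(2)[OF that] by (auto split: if_splits)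
    qed
    then have "U = T" using f(1) by (auto simp: bij_betw_def image_iff)
    with False show False by simp
  qed
  then show ?thesis using False by simp
qed

text \<open>The action returns 0 outside \<open>ksubsets N m\<close>, so only functions with that
  default can be fixed by the identity.\<close>

lemma ext_act_one:
  assumes "\<And>T. T \<notin> ksubsets N m \<Longrightarrow> x T = 0"
  shows "ext_act N m (1\<^sub>m N) x = x"
proof
  fix T
  show "ext_act N m (1\<^sub>m N) x T = x T"
  proof (cases "T \<in> ksubsets N m")
    case T: True
    have "ext_act N m (1\<^sub>m N) x T = (\<Sum>U\<in>ksubsets N m. if U = T then x U else 0)"
      unfolding ext_act_eq[OF one_carrier_mat T]
      by (intro sum.cong) (auto simp: det_select_mat_one[OF T])
    then show ?thesis using T by simp
  qed (simp add: assms ext_act_outside)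
qed

subsection \<open>Coordinates of the vector of minors\<close>

definition ef_set :: "nat \<Rightarrow> nat set \<Rightarrow> nat set \<Rightarrow> nat set" where
  "ef_set n R S = R \<union> (+) n ` S"

text \<open>All indices of \<open>F\<close> exceed those of \<open>E\<close>, so no reordering takes
  place. This keeps signs out of \<open>ef_wedge\<close>.\<close>

lemma sorted_list_of_ef_set:
  assumes "R \<subseteq> {0..<n}" "S \<subseteq> {0..<n}"
  shows "sorted_list_of_set (ef_set n R S) = sorted_list_of_set R @ map ((+) n) (sorted_list_of_set S)"
proof -
  have fin: "finite R" "finite S" using assms by (auto intro: finite_subset)
  let ?l = "sorted_list_of_set R @ map ((+) n) (sorted_list_of_set S)"
  have "sorted (map ((+) n) (sorted_list_of_set S))"
    by (simp add: sorted_map sorted_wrt_mono_rel[of _ "(\<le>)"])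
  then have "sorted ?l" "distinct ?l" "set ?l = ef_set n R S"
    using assms fin by (auto simp: sorted_append ef_set_def distinct_map)
  then show ?thesis using sorted_list_of_set.idem_if_sorted_distinct[of ?l] by simp
qed

lemma ef_set_ksubsets:
  assumes "R \<subseteq> {0..<n}" "S \<subseteq> {0..<n}" "card R + card S = m"
  shows "ef_set n R S \<in> ksubsets (2 * n) m"
proof -
  have fin: "finite R" "finite S" using assms by (auto intro: finite_subset)
  have "card (ef_set n R S) = card R + card ((+) n ` S)"
    unfolding ef_set_def using assms fin by (intro card_Un_disjoint) auto
  also have "card ((+) n ` S) = card S" by (simp add: card_image)
  finally show ?thesis using assms by (auto simp: ksubsets_def ef_set_def)
qed

lemma ef_set_decompose:
  assumes "T \<in> ksubsets (2 * n) m"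
  obtains R S where "R \<subseteq> {0..<n}" "S \<subseteq> {0..<n}" "card R + card S = m" "T = ef_set n R S"
proof
  let ?R = "T \<inter> {0..<n}" and ?S = "{j \<in> {0..<n}. n + j \<in> T}"
  note T = ksubsetsD[OF assms]
  show "T = ef_set n ?R ?S"
  proof (intro equalityI subsetI)
    fix t assume t: "t \<in> T"
    show "t \<in> ef_set n ?R ?S"
    proof (cases "t < n")
      case False
      then have "t = n + (t - n)" "t - n < n" using t T by auto
      then show ?thesis using t by (auto simp: ef_set_def image_iff intro!: exI[of _ "t - n"])
    qed (use t in \<open>simp add: ef_set_def\<close>)
  qed (auto simp: ef_set_def)
  then have "card T = card (?R \<union> (+) n ` ?S)" unfolding ef_set_def by (rule arg_cong)
  also have "\<dots> = card ?R + card ((+) n ` ?S)" by (rule card_Un_disjoint) auto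
  finally have "card T = card ?R + card ((+) n ` ?S)" .
  then show "card ?R + card ?S = m" using T by (simp add: card_image)
qed auto

lemma minor_vec_eq:
  assumes "I \<subseteq> {0..<n}" "J \<subseteq> {0..<n}" "card I = card J"
  shows "minor_vec n I J = (\<lambda>T. if T = ef_set n ({0..<n} - I) J then 1 else 0)"
proof
  fix T
  let ?R = "{0..<n} - I"
  let ?T0 = "ef_set n ?R J"
  have c: "card ?R + card J = n"
    using assms card_mono[of "{0..<n}" I] by (simp add: card_Diff_subset finite_subset)
  have T0: "?T0 \<in> ksubsets (2 * n) n" using assms c by (intro ef_set_ksubsets) auto
  have sl: "sorted_list_of_set ?T0 = sorted_list_of_set ?R @ map ((+) n) (sorted_list_of_set J)"
    using assms by (intro sorted_list_of_ef_set) auto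
  \<comment> \<open>Unit vectors are written as images under the identity matrix, so that the
    coordinates become minors of the identity.\<close>
  have mv: "minor_vec n I J = wedge (2 * n) (map (\<lambda>u. 1\<^sub>m (2 * n) *\<^sub>v unit_vec (2 * n) u) (sorted_list_of_set ?T0))"
    unfolding minor_vec_def ef_wedge_def sl by (simp add: e_vec_def f_vec_def o_def cong: map_cong)
  show "minor_vec n I J T = (if T = ?T0 then 1 else 0)"
  proof (cases "T \<in> ksubsets (2 * n) n")
    case True
    then show ?thesis
      unfolding mv using ksubsetsD[OF T0]
      by (subst wedge_unit_vecs[OF _ True]) (auto simp: det_select_mat_one[OF True T0])
  next
    case False
    then show ?thesis using T0 ksubsetsD[OF T0] unfolding mv by (auto simp: wedge_def)
  qed
qed

text \<open>\<open>pick I\<close> enumerates \<open>I\<close> increasingly; this links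
  \<open>submatrix\<close> to list-indexed minors.\<close>

lemma pick_eq_nth_sorted_list:
  assumes "finite I" "i < card I"
  shows "pick I i = sorted_list_of_set I ! i"
proof -
  let ?l = "map (pick I) [0..<card I]"
  have mono: "pick I i < pick I j" if "i < j" "j < card I" for i j
    using that by (intro pick_mono) auto
  have inj: "inj_on (pick I) {0..<card I}"
    using mono by (auto intro!: inj_onI simp: atLeast0LessThan) (metis linorder_neqE_nat less_irrefl)
  have "set ?l \<subseteq> I" using pick_in_set by auto
  moreover have "card (set ?l) = card I" using inj by (simp add: card_image)
  ultimately have "set ?l = I" using assms card_subset_eq by blast
  moreover have "sorted ?l" "distinct ?l"
    using mono inj by (auto simp: sorted_iff_nth_mono_less distinct_map less_imp_le)
  ultimately have "sorted_list_of_set I = ?l"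
    using sorted_list_of_set.idem_if_sorted_distinct[of ?l] by simp
  then show ?thesis using assms by simp
qed

lemma minor_eq_det_select_mat:
  assumes "A \<in> carrier_mat n n" "I \<subseteq> {0..<n}" "J \<subseteq> {0..<n}"
  shows "minor A I J = det (select_mat A (sorted_list_of_set I) (sorted_list_of_set J))"
proof -
  have fin: "finite I" "finite J" using assms by (auto intro: finite_subset)
  have "{i. i < n \<and> i \<in> I} = I" "{i. i < n \<and> i \<in> J} = J" using assms by auto
  then have "submatrix A I J = select_mat A (sorted_list_of_set I) (sorted_list_of_set J)"
    using assms fin by (intro eq_matI) (auto simp: submatrix_def pick_eq_nth_sorted_list)
  then show ?thesis by (simp add: minor_def)
qed

lemma minors_of_outside: "T \<notin> ksubsets (2 * n) n \<Longrightarrow> minors_of n A T = 0"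
  by (simp add: minors_of_def wedge_def)

text \<open>The sign \<open>s\<close> comes from reordering the vectors as those with index in
  \<open>R\<close> followed by the rest, so it is independent of \<open>A\<close>. In this order the
  matrix of coordinates is block lower triangular, with an identity block for \<open>R\<close> and
  the transpose of the wanted submatrix of \<open>A\<close>.\<close>

lemma minors_of_ef_set:
  assumes R: "R \<subseteq> {0..<n}" and S: "S \<subseteq> {0..<n}" and c: "card R + card S = n"
  obtains s where "s \<noteq> 0"
    "\<And>A. A \<in> carrier_mat n n \<Longrightarrow> minors_of n A (ef_set n R S) = s * minor A ({0..<n} - R) S"
proof -
  let ?I = "{0..<n} - R"
  define rs where "rs = sorted_list_of_set R"
  define qs where "qs = sorted_list_of_set ?I"
  define ss where "ss = sorted_list_of_set S"
  have fin: "finite R" "finite S" using assms by (auto intro: finite_subset)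
  have lists: "set rs = R" "distinct rs" "set qs = ?I" "distinct qs" "set ss = S" "distinct ss"
    "length rs = card R" "length ss = card S"
    using fin by (simp_all add: rs_def qs_def ss_def)
  have lis: "length qs = card S"
    using R fin c by (simp add: qs_def card_Diff_subset)
  have mem: "rs ! i \<in> R" if "i < card R" for i using that lists nth_mem[of i rs] by simp
  have mem': "qs ! i \<in> ?I" "ss ! i \<in> S" if "i < card S" for i
    using that lists lis nth_mem[of i qs] nth_mem[of i ss] by simp_all
  have nth_lt: "\<And>i. i < card R \<Longrightarrow> rs ! i < n" "\<And>i. i < card S \<Longrightarrow> qs ! i < n" "\<And>i. i < card S \<Longrightarrow> ss ! i < n"
    using mem mem' R S by force+
  have rs_lt: "rs ! i < 2 * n" if "i < card R" for i using nth_lt(1)[OF that] by simp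
  have ne: "rs ! i \<noteq> qs ! j" if "i < card R" "j < card S" for i j
    using mem[of i] mem'(1)[of j] that by auto
  have T: "ef_set n R S \<in> ksubsets (2 * n) n" using assms by (rule ef_set_ksubsets)
  have sl: "sorted_list_of_set (ef_set n R S) = rs @ map ((+) n) ss"
    unfolding rs_def ss_def using R S by (rule sorted_list_of_ef_set)
  obtain s :: complex where s: "s * s = 1"
    "\<And>M ys. length ys = length [0..<n] \<Longrightarrow>
      det (select_mat M ys (rs @ qs)) = s * det (select_mat M ys [0..<n])"
    by (rule det_select_mat_reorder[of "[0..<n]" "rs @ qs"]) (use R lists in auto)
  have "minors_of n A (ef_set n R S) = s * minor A ?I S" if A: "A \<in> carrier_mat n n" for A
  proof -
    \<comment> \<open>Since \<open>wedge\<close> places its vectors in columns, column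
      \<open>j\<close> of \<open>W\<close> is row \<open>j\<close> of
      \<open>(1 | A)\<close>.\<close>
    define W :: "complex mat"
      where "W = mat (2 * n) n (\<lambda>(a, j). if a < n then (if a = j then 1 else 0) else A $$ (j, a - n))"
    define ts where "ts = rs @ map ((+) n) ss"
    have len: "length ts = n" using lists(7,8) c by (simp add: ts_def)
    have ts_lt: "ts ! i < 2 * n" "ts ! i < n + n" "ts ! i - n < n" if "i < n" for i
      using that nth_lt(1)[of i] nth_lt(3)[of "i - card R"] lists(7,8) c by (auto simp: nth_append ts_def)
    have mins: "minors_of n A (ef_set n R S) = det (select_mat W ts [0..<n])"
    proof -
      have "mat n n (\<lambda>(i, j). (map (\<lambda>i. unit_vec n i @\<^sub>v row A i) [0..<n] ! j) $ (ts ! i)) =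
          select_mat W ts [0..<n]"
        using A len ts_lt by (intro eq_matI) (auto simp: W_def)
      then show ?thesis using T by (simp add: minors_of_def wedge_def sl flip: ts_def)
    qed
    have "select_mat W ts (rs @ qs) = four_block_mat (1\<^sub>m (card R)) (0\<^sub>m (card R) (card S))
        (select_mat W (map ((+) n) ss) rs) (transpose_mat (select_mat A qs ss))"
      using lists(2,7,8) lis nth_lt rs_lt ne A
      by (intro eq_matI) (auto simp: ts_def nth_append W_def nth_eq_iff_index_eq)
    also have "det \<dots> = det (1\<^sub>m (card R) :: complex mat) * det (transpose_mat (select_mat A qs ss))"
      using lists(7,8) lis by (intro det_four_block_mat_upper_right_zero) auto
    also have "\<dots> = det (select_mat A qs ss)"
      using lists(7,8) lis by (simp add: det_transpose[of _ "card S"])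
    also have "\<dots> = minor A ?I S"
      using minor_eq_det_select_mat[OF A _ S, of ?I] by (simp add: qs_def ss_def)
    finally have "minor A ?I S = s * minors_of n A (ef_set n R S)"
      using s(2)[of ts W] len mins by simp
    then show ?thesis using s(1) by (simp flip: mult.assoc)
  qed
  moreover have "s \<noteq> 0" using s(1) by auto
  ultimately show ?thesis using that by blast
qed

section \<open>Full pairs and the vanishing of E-minors\<close>

definition pairs_in :: "nat \<Rightarrow> nat set \<Rightarrow> nat set" where
  "pairs_in n T = {i \<in> {0..<n}. i \<in> T \<and> n + i \<in> T}"

text \<open>For the minor with rows \<open>I = {0..<n} - R\<close> this set is \<open>S - I\<close>,
  the columns that are not rows. An E-minor of size \<open>k\<close> therefore has exactly
  \<open>k\<close> full pairs.\<close>

lemma pairs_in_ef_set: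
  assumes "R \<subseteq> {0..<n}" "S \<subseteq> {0..<n}"
  shows "pairs_in n (ef_set n R S) = R \<inter> S"
  using assms by (auto simp: pairs_in_def ef_set_def)

text \<open>From right to left, an E-minor of size \<open>k\<close> is up to sign a coordinate with
  \<open>k\<close> full pairs. From left to right, a coordinate with at least \<open>k\<close> full
  pairs is a minor with at least \<open>k\<close> rows outside its column set, and the expansion
  along \<open>k\<close> such rows involves only E-minors of size \<open>k\<close>.\<close>

lemma E_minors_vanish_iff:
  assumes A: "A \<in> carrier_mat n n"
  shows "(\<forall>(I, J) \<in> E_indices n k. minor A I J = 0) \<longleftrightarrow>
    (\<forall>T \<in> ksubsets (2 * n) n. k \<le> card (pairs_in n T) \<longrightarrow> minors_of n A T = 0)"
    (is "?L \<longleftrightarrow> ?R")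
proof
  assume R: ?R
  show ?L
  proof (intro ballI, clarify)
    fix I J assume "(I, J) \<in> E_indices n k"
    then have IJ: "I \<subseteq> {0..<n}" "J \<subseteq> {0..<n}" "card I = k" "card J = k" "I \<inter> J = {}"
      by (auto simp: E_indices_def)
    have c: "card ({0..<n} - I) + card J = n"
      using IJ card_mono[of "{0..<n}" I] by (simp add: card_Diff_subset finite_subset)
    obtain s where s: "s \<noteq> 0" "minors_of n A (ef_set n ({0..<n} - I) J) = s * minor A I J"
      using minors_of_ef_set[of "{0..<n} - I" n J] IJ c A double_diff[of I "{0..<n}" "{0..<n}"]
      by (metis Diff_subset order_refl)
    have "pairs_in n (ef_set n ({0..<n} - I) J) = J"
      using IJ by (subst pairs_in_ef_set) auto
    then have "minors_of n A (ef_set n ({0..<n} - I) J) = 0"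
      using R ef_set_ksubsets[of "{0..<n} - I" n J n] IJ c by simp
    then show "minor A I J = 0" using s by simp
  qed
next
  assume L: ?L
  show ?R
  proof (intro ballI impI)
    fix T assume "T \<in> ksubsets (2 * n) n" and k: "k \<le> card (pairs_in n T)"
    then obtain R S where RS: "R \<subseteq> {0..<n}" "S \<subseteq> {0..<n}" "card R + card S = n" "T = ef_set n R S"
      by (elim ef_set_decompose)
    define I where "I = {0..<n} - R"
    have fin: "finite R" "finite S" "finite I" using RS by (auto intro: finite_subset simp: I_def)
    have cI: "card I = card S" using RS fin by (simp add: I_def card_Diff_subset)
    have "card (I - S) = card (S - I)"
      using cI fin card_Int_Diff[of I S] card_Int_Diff[of S I] by (simp add: Int_commute)
    also have "S - I = pairs_in n T" using RS by (auto simp: pairs_in_ef_set I_def)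
    \<comment> \<open>The rows \<open>I0\<close> avoid \<open>S\<close>, so together with any
      \<open>k\<close> columns from \<open>S\<close> they index an E-minor.\<close>
    finally obtain I0 where I0: "I0 \<subseteq> I - S" "card I0 = k" using k by (metis obtain_subset_with_card_n)
    have I0I: "I0 \<subseteq> I" using I0 by auto
    then have fin0: "finite I0" using fin by (auto intro: finite_subset)
    have "det (select_mat A (sorted_list_of_set I0 @ sorted_list_of_set (I - I0)) (sorted_list_of_set S)) = 0"
    proof (rule det_rows_vanish)
      have "card (I - I0) = card I - k" "k \<le> card I"
        using I0 I0I fin fin0 card_mono[of I I0] by (auto simp: card_Diff_subset)
      then show "length (sorted_list_of_set S) = length (sorted_list_of_set I0 @ sorted_list_of_set (I - I0))"
        using I0 cI by simp
    next
      fix us assume us: "distinct us" "set us \<subseteq> set (sorted_list_of_set S)"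
        "length us = length (sorted_list_of_set I0)"
      then have us': "set us \<subseteq> S" "card (set us) = k" using fin I0 by (auto simp: distinct_card)
      obtain s :: complex where "\<And>M ys. length ys = length (sorted_list_of_set (set us)) \<Longrightarrow>
          det (select_mat M ys us) = s * det (select_mat M ys (sorted_list_of_set (set us)))"
        by (rule det_select_mat_reorder[of "sorted_list_of_set (set us)" us]) (use us in auto)
      then have "det (select_mat A (sorted_list_of_set I0) us) =
          s * det (select_mat A (sorted_list_of_set I0) (sorted_list_of_set (set us)))"
        using us' I0 by simp
      moreover have "(I0, set us) \<in> E_indices n k"
        using us' I0 RS by (auto simp: E_indices_def I_def)
      ultimately show "det (select_mat A (sorted_list_of_set I0) us) = 0"
        using L A by (auto simp: E_indices_def minor_eq_det_select_mat)
    qed simp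
    moreover obtain s :: complex where "\<And>M ys. length ys = length (sorted_list_of_set I0 @ sorted_list_of_set (I - I0)) \<Longrightarrow>
        det (select_mat M (sorted_list_of_set I) ys) =
        s * det (select_mat M (sorted_list_of_set I0 @ sorted_list_of_set (I - I0)) ys)"
      by (rule det_select_mat_reorder[of "sorted_list_of_set I0 @ sorted_list_of_set (I - I0)" "sorted_list_of_set I"])
        (use fin fin0 I0 in auto)
    moreover have "length (sorted_list_of_set I0 @ sorted_list_of_set (I - I0)) = card S"
      using I0 I0I fin fin0 card_mono[of I I0] cI by (auto simp: card_Diff_subset)
    ultimately have "minor A I S = 0"
      using A RS by (simp add: minor_eq_det_select_mat I_def)
    moreover obtain s where "minors_of n A T = s * minor A I S"
      using minors_of_ef_set[OF RS(1-3)] A RS(4) unfolding I_def by metis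
    ultimately show "minors_of n A T = 0" by simp
  qed
qed

subsection \<open>Block matrices with diagonal blocks\<close>

definition dmat :: "nat \<Rightarrow> (nat \<Rightarrow> 'a :: zero) \<Rightarrow> 'a mat" where
  "dmat n a = mat n n (\<lambda>(i, j). if i = j then a i else 0)"

lemma dmat_carrier [simp]: "dmat n a \<in> carrier_mat n n"
  by (simp add: dmat_def)

lemma dim_dmat [simp]: "dim_row (dmat n a) = n" "dim_col (dmat n a) = n"
  by (simp_all add: dmat_def)

lemma index_dmat [simp]: "i < n \<Longrightarrow> j < n \<Longrightarrow> dmat n a $$ (i, j) = (if i = j then a i else 0)"
  by (simp add: dmat_def)

lemma dmat_mult [simp]:
  fixes a b :: "nat \<Rightarrow> 'a :: semiring_0"
  shows "dmat n a * dmat n b = dmat n (\<lambda>i. a i * b i)"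
proof (rule eq_matI)
  fix i j assume "i < dim_row (dmat n (\<lambda>i. a i * b i))" "j < dim_col (dmat n (\<lambda>i. a i * b i))"
  then have ij: "i < n" "j < n" by simp_all
  have "(dmat n a * dmat n b) $$ (i, j) = (\<Sum>k = 0..<n. (if i = k then a i else 0) * (if k = j then b k else 0))"
    using ij by (auto simp: scalar_prod_def intro!: sum.cong)
  also have "\<dots> = (\<Sum>k = 0..<n. if k = i then (if i = j then a i * b i else 0) else 0)"
    by (intro sum.cong) auto
  also have "\<dots> = dmat n (\<lambda>i. a i * b i) $$ (i, j)" using ij by simp
  finally show "(dmat n a * dmat n b) $$ (i, j) = dmat n (\<lambda>i. a i * b i) $$ (i, j)" .
qed simp_all

lemma diagonal_mat_eq_dmat:
  assumes "D \<in> carrier_mat n n" "diagonal_mat D"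
  shows "D = dmat n (\<lambda>i. D $$ (i, i))"
  using assms by (intro eq_matI) (auto simp: diagonal_mat_def)

text \<open>At \<open>i\<close> the functions give the 2 by 2 matrix with rows
  \<open>(a i, b i)\<close> and \<open>(c i, d i)\<close>, acting on the span of \<open>e_i\<close>
  and \<open>f_i\<close>; products and inverses are thus computed copy by copy.\<close>

definition block_dmat :: "nat \<Rightarrow> (nat \<Rightarrow> 'a) \<Rightarrow> (nat \<Rightarrow> 'a) \<Rightarrow> (nat \<Rightarrow> 'a) \<Rightarrow> (nat \<Rightarrow> 'a) \<Rightarrow> 'a :: zero mat" where
  "block_dmat n a b c d = four_block_mat (dmat n a) (dmat n b) (dmat n c) (dmat n d)"

lemma block_dmat_carrier [simp]: "block_dmat n a b c d \<in> carrier_mat (2 * n) (2 * n)"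
  by (auto simp: block_dmat_def)

lemma dim_block_dmat [simp]:
  "dim_row (block_dmat n a b c d) = 2 * n" "dim_col (block_dmat n a b c d) = 2 * n"
  by (simp_all add: block_dmat_def)

lemma index_block_dmat:
  assumes "i < 2 * n" "j < 2 * n"
  shows "block_dmat n a b c d $$ (i, j) =
    (if i < n then if j = i then a i else if j = n + i then b i else 0
     else if j = i then d (i - n) else if n + j = i then c j else 0)"
  using assms by (auto simp: block_dmat_def)

lemma block_dmat_mult:
  fixes a b c d :: "nat \<Rightarrow> 'a :: semiring_0"
  shows "block_dmat n a b c d * block_dmat n a' b' c' d' =
    block_dmat n (\<lambda>i. a i * a' i + b i * c' i) (\<lambda>i. a i * b' i + b i * d' i)
      (\<lambda>i. c i * a' i + d i * c' i) (\<lambda>i. c i * b' i + d i * d' i)"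
proof -
  have add: "dmat n u + dmat n v = dmat n (\<lambda>i. u i + v i)" for u v :: "nat \<Rightarrow> 'a"
    by (intro eq_matI) auto
  show ?thesis
    unfolding block_dmat_def by (subst mult_four_block_mat[where ?nr1.0 = n and ?n1.0 = n and ?n2.0 = n
      and ?nr2.0 = n and ?nc1.0 = n and ?nc2.0 = n]) (simp_all add: add)
qed

lemma block_dmat_one: "block_dmat n (\<lambda>_. 1) (\<lambda>_. 0) (\<lambda>_. 0) (\<lambda>_. 1) = (1\<^sub>m (2 * n) :: 'a :: semiring_1 mat)"
  by (intro eq_matI) (auto simp: index_block_dmat)

lemma block_dmat_cong:
  assumes "\<And>i. i < n \<Longrightarrow> a i = a' i" "\<And>i. i < n \<Longrightarrow> b i = b' i"
    "\<And>i. i < n \<Longrightarrow> c i = c' i" "\<And>i. i < n \<Longrightarrow> d i = d' i"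
  shows "block_dmat n a b c d = block_dmat n a' b' c' d'"
  using assms by (intro eq_matI) (auto simp: index_block_dmat)

lemma SL2_powerE:
  assumes "g \<in> SL2_power n"
  obtains a b c d where "g = block_dmat n a b c d" "\<And>i. i < n \<Longrightarrow> a i * d i - b i * c i = 1"
proof -
  obtain D1 D2 D3 D4 where g: "g = four_block_mat D1 D2 D3 D4"
    and D: "D1 \<in> carrier_mat n n" "D2 \<in> carrier_mat n n" "D3 \<in> carrier_mat n n" "D4 \<in> carrier_mat n n"
      "diagonal_mat D1" "diagonal_mat D2" "diagonal_mat D3" "diagonal_mat D4"
    and det: "D1 * D4 - D2 * D3 = 1\<^sub>m n"
    using assms by (auto simp: SL2_power_def)
  define a b c d where "a = (\<lambda>i. D1 $$ (i, i))" and "b = (\<lambda>i. D2 $$ (i, i))"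
    and "c = (\<lambda>i. D3 $$ (i, i))" and "d = (\<lambda>i. D4 $$ (i, i))"
  have eq: "D1 = dmat n a" "D2 = dmat n b" "D3 = dmat n c" "D4 = dmat n d"
    unfolding a_def b_def c_def d_def using D by (auto intro: diagonal_mat_eq_dmat)
  have "a i * d i - b i * c i = 1" if "i < n" for i
    using arg_cong[OF det, of "\<lambda>M. M $$ (i, i)"] that by (simp add: eq)
  then show ?thesis using that g eq by (auto simp: block_dmat_def)
qed

text \<open>Diagonal blocks commute, so the determinant is that of \<open>D1 * D4 - D2 * D3\<close>,
  here the identity.\<close>

lemma det_block_dmat:
  fixes a b c d :: "nat \<Rightarrow> 'a :: idom"
  assumes "\<And>i. i < n \<Longrightarrow> a i * d i - b i * c i = 1"
  shows "det (block_dmat n a b c d) = 1"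
proof -
  have "det (block_dmat n a b c d) = det (dmat n a * dmat n d - dmat n b * dmat n c)"
    unfolding block_dmat_def by (rule det_four_block_mat[where n = n]) (simp_all add: mult.commute)
  also have "dmat n a * dmat n d - dmat n b * dmat n c = 1\<^sub>m n"
    using assms by (intro eq_matI) auto
  finally show ?thesis by simp
qed

lemma det_principal_block_dmat:
  fixes a b c d :: "nat \<Rightarrow> 'a :: idom"
  assumes det: "\<And>i. i < n \<Longrightarrow> a i * d i - b i * c i = 1"
    and triv: "\<And>i. i < n \<Longrightarrow> i \<notin> K \<Longrightarrow> a i = 1 \<and> b i = 0 \<and> c i = 0 \<and> d i = 1"
    and T: "T \<subseteq> {..<2 * n}"
    and full: "\<And>i. i < n \<Longrightarrow> i \<in> K \<Longrightarrow> i \<in> T \<longleftrightarrow> n + i \<in> T"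
  shows "det (select_mat (block_dmat n a b c d) (sorted_list_of_set T) (sorted_list_of_set T)) = 1"
proof -
  \<comment> \<open>\<open>G\<close> agrees with the given matrix on \<open>T\<close> and with the identity elsewhere, so that the principal
    minor at \<open>T\<close> becomes a full determinant.\<close>
  define u where "u e x = (\<lambda>i. if i \<in> K \<and> i \<in> T then x i else e)" for e and x :: "nat \<Rightarrow> 'a"
  define G where "G = block_dmat n (u 1 a) (u 0 b) (u 0 c) (u 1 d)"
  define g where "g = block_dmat n a b c d"
  have finT: "finite T" using T by (rule finite_subset) simp
  define ts where "ts = sorted_list_of_set T"
  define cs where "cs = sorted_list_of_set ({..<2 * n} - T)"
  have ts: "set ts = T" "distinct ts" using finT by (simp_all add: ts_def)
  have cs: "set cs = {..<2 * n} - T" "distinct cs" by (simp_all add: cs_def)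
  have ts_mem: "ts ! i \<in> T" if "i < length ts" for i using ts that nth_mem by blast
  have ts_lt: "ts ! i < 2 * n" if "i < length ts" for i using ts_mem[OF that] T by auto
  have cs_mem: "cs ! i \<in> {..<2 * n} - T" if "i < length cs" for i using cs that nth_mem by blast
  \<comment> \<open>Inside \<open>K\<close> the indices of \<open>T\<close> come in whole pairs,
    where \<open>u\<close> keeps the given entries; outside \<open>K\<close> both matrices are
    trivial.\<close>
  have G_T: "G $$ (x, y) = g $$ (x, y)" if "x \<in> T" "y \<in> T" for x y
  proof -
    have "x < 2 * n" "y < 2 * n" using that T by auto
    then show ?thesis
      using that full[of x] full[of y] full[of "x - n"] triv[of x] triv[of y] triv[of "x - n"]
      by (auto simp: G_def g_def index_block_dmat u_def)
  qed
  have G_T': "G $$ (x, y) = (if x = y then 1 else 0)"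
    if "x < 2 * n" "y < 2 * n" "x \<notin> T \<or> y \<notin> T" for x y
  proof -
    have "x - n < n" using that(1) by simp
    then show ?thesis
      using that full[of x] full[of y] full[of "x - n"]
      by (auto simp: G_def index_block_dmat u_def)
  qed
  obtain s1 :: 'a where s1: "s1 * s1 = 1"
    "\<And>A ys. length ys = length [0..<2 * n] \<Longrightarrow> det (select_mat A (ts @ cs) ys) = s1 * det (select_mat A [0..<2 * n] ys)"
    "\<And>A ys. length ys = length [0..<2 * n] \<Longrightarrow> det (select_mat A ys (ts @ cs)) = s1 * det (select_mat A ys [0..<2 * n])"
    by (rule det_select_mat_reorder[of "[0..<2 * n]" "ts @ cs"]) (use ts cs T in auto)
  have len: "length (ts @ cs) = 2 * n"
  proof -
    have "distinct (ts @ cs)" "set (ts @ cs) = {..<2 * n}" using ts cs T by auto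
    then show ?thesis by (metis card_lessThan distinct_card)
  qed
  \<comment> \<open>Rows and columns are reordered by the same list, so the sign \<open>s1\<close>
    appears twice and cancels.\<close>
  have "det g' = 1 \<Longrightarrow> g' \<in> carrier_mat (2 * n) (2 * n) \<Longrightarrow> det (select_mat g' (ts @ cs) (ts @ cs)) = 1" for g' :: "'a mat"
  proof -
    assume g': "det g' = 1" "g' \<in> carrier_mat (2 * n) (2 * n)"
    have "select_mat g' [0..<2 * n] [0..<2 * n] = g'"
      using g'(2) by (intro eq_matI) auto
    then show "det (select_mat g' (ts @ cs) (ts @ cs)) = 1"
      using s1 len g'(1) by simp
  qed
  moreover have "det G = 1"
    unfolding G_def by (rule det_block_dmat) (use det in \<open>auto simp: u_def\<close>)
  ultimately have "1 = det (select_mat G (ts @ cs) (ts @ cs))" by (simp add: G_def)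
  also have "select_mat G (ts @ cs) (ts @ cs) = four_block_mat (select_mat g ts ts)
      (0\<^sub>m (length ts) (length cs)) (0\<^sub>m (length cs) (length ts)) (1\<^sub>m (length cs))"
  proof (rule eq_matI)
    fix i j
    assume "i < dim_row (four_block_mat (select_mat g ts ts)
      (0\<^sub>m (length ts) (length cs)) (0\<^sub>m (length cs) (length ts)) (1\<^sub>m (length cs) :: 'a mat))"
      "j < dim_col (four_block_mat (select_mat g ts ts)
      (0\<^sub>m (length ts) (length cs)) (0\<^sub>m (length cs) (length ts)) (1\<^sub>m (length cs) :: 'a mat))"
    then have ij: "i < length ts + length cs" "j < length ts + length cs" by simp_all
    show "select_mat G (ts @ cs) (ts @ cs) $$ (i, j) = four_block_mat (select_mat g ts ts)
      (0\<^sub>m (length ts) (length cs)) (0\<^sub>m (length cs) (length ts)) (1\<^sub>m (length cs)) $$ (i, j)"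
    proof (cases "i < length ts"; cases "j < length ts")
      assume "i < length ts" "j < length ts"
      then show ?thesis using ij by (simp add: nth_append G_T ts_mem)
    next
      assume a: "i < length ts" "\<not> j < length ts"
      moreover from this have "j - length ts < length cs" using ij by linarith
      ultimately show ?thesis using ij ts_mem[of i] ts_lt[of i] cs_mem[of "j - length ts"]
        by (auto simp: nth_append G_T')
    next
      assume a: "\<not> i < length ts" "j < length ts"
      moreover from this have "i - length ts < length cs" using ij by linarith
      ultimately show ?thesis using ij ts_mem[of j] ts_lt[of j] cs_mem[of "i - length ts"]
        by (auto simp: nth_append G_T')
    next
      assume a: "\<not> i < length ts" "\<not> j < length ts"
      moreover from this have "i - length ts < length cs" "j - length ts < length cs" using ij by linarith+
      ultimately show ?thesis using ij cs_mem[of "j - length ts"] cs_mem[of "i - length ts"] cs(2)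
        by (auto simp: nth_append G_T' nth_eq_iff_index_eq)
    qed
  qed simp_all
  also have "det \<dots> = det (select_mat g ts ts)"
    by (subst det_four_block_mat_upper_right_zero[where n = "length ts" and m = "length cs"]) simp_all
  finally show ?thesis by (simp add: g_def ts_def)
qed

text \<open>A nonzero minor gives a bijection from \<open>U\<close> to \<open>T\<close> that moves
  an index only within a pair belonging to \<open>K\<close>. As \<open>T\<close> contains both or
  none of each such pair, \<open>U \<subseteq> T\<close>, and equal cardinality gives
  \<open>U = T\<close>.\<close>

lemma det_select_block_dmat_fixed:
  fixes a b c d :: "nat \<Rightarrow> 'a :: idom"
  assumes det: "\<And>i. i < n \<Longrightarrow> a i * d i - b i * c i = 1"
    and triv: "\<And>i. i < n \<Longrightarrow> i \<notin> K \<Longrightarrow> a i = 1 \<and> b i = 0 \<and> c i = 0 \<and> d i = 1"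
    and T: "T \<in> ksubsets (2 * n) m"
    and full: "\<And>i. i < n \<Longrightarrow> i \<in> K \<Longrightarrow> i \<in> T \<longleftrightarrow> n + i \<in> T"
    and U: "U \<in> ksubsets (2 * n) m"
  shows "det (select_mat (block_dmat n a b c d) (sorted_list_of_set U) (sorted_list_of_set T)) = (if U = T then 1 else 0)"
proof (cases "U = T")
  case True
  then show ?thesis
    using det_principal_block_dmat[where K = K and T = T, OF det triv _ full] ksubsetsD[OF T] by simp
next
  case False
  have "det (select_mat (block_dmat n a b c d) (sorted_list_of_set U) (sorted_list_of_set T)) = 0"
  proof (rule ccontr)
    assume nz: "det (select_mat (block_dmat n a b c d) (sorted_list_of_set U) (sorted_list_of_set T)) \<noteq> 0"
    obtain f where f: "bij_betw f U T" "\<And>t. t \<in> U \<Longrightarrow> block_dmat n a b c d $$ (t, f t) \<noteq> 0"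
      using bij_of_det_select_mat_nonzero[OF nz] ksubsetsD[OF T] ksubsetsD[OF U] by auto
    have "U \<subseteq> T"
    proof
      fix t assume t: "t \<in> U"
      then have fT: "f t \<in> T" using f(1) by (rule bij_betwE[rule_format, rotated])
      have lt: "t < 2 * n" "f t < 2 * n" using t fT ksubsetsD[OF T] ksubsetsD[OF U] by auto
      show "t \<in> T"
      proof (cases "t < n")
        case True
        then show ?thesis
          using f(2)[OF t] lt fT triv[of t] full[of t] by (auto simp: index_block_dmat split: if_splits)
      next
        case False
        then show ?thesis
          using f(2)[OF t] lt fT triv[of "f t"] full[of "f t"] by (auto simp: index_block_dmat split: if_splits)
      qed
    qed
    then show False
      using False ksubsetsD[OF T] ksubsetsD[OF U] by (metis card_subset_eq)
  qed
  then show ?thesis using False by simp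
qed

lemma transpose_block_dmat: "transpose_mat (block_dmat n a b c d) = block_dmat n a c b d"
  by (intro eq_matI) (auto simp: index_block_dmat)

subsection \<open>Invariance\<close>

text \<open>Fixing \<open>e_i\<close> and \<open>f_i\<close> prescribes columns \<open>i\<close> and
  \<open>n + i\<close> of \<open>g\<close>, hence all four entries of the copy with index
  \<open>i\<close>.\<close>

lemma SL2_power_onE:
  assumes "g \<in> SL2_power_on n K"
  obtains a b c d where "g = block_dmat n a b c d" "\<And>i. i < n \<Longrightarrow> a i * d i - b i * c i = 1"
    "\<And>i. i < n \<Longrightarrow> i \<notin> K \<Longrightarrow> a i = 1 \<and> b i = 0 \<and> c i = 0 \<and> d i = 1"
proof -
  from assms have "g \<in> SL2_power n" by (simp add: SL2_power_on_def)
  then obtain a b c d where g: "g = block_dmat n a b c d"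
    and det: "\<And>i. i < n \<Longrightarrow> a i * d i - b i * c i = 1"
    by (rule SL2_powerE) blast
  have "a i = 1 \<and> b i = 0 \<and> c i = 0 \<and> d i = 1" if i: "i < n" "i \<notin> K" for i
  proof -
    have col: "g $$ (t, u) = (unit_vec (2 * n) u :: complex vec) $ t"
      if "g *\<^sub>v unit_vec (2 * n) u = unit_vec (2 * n) u" "t < 2 * n" "u < 2 * n" for t u
    proof -
      have "(g *\<^sub>v unit_vec (2 * n) u) $ t = g $$ (t, u)"
        using that(2,3) by (simp add: g scalar_prod_right_unit)
      then show ?thesis using that(1) by simp
    qed
    have "g *\<^sub>v unit_vec (2 * n) i = unit_vec (2 * n) i"
      "g *\<^sub>v unit_vec (2 * n) (n + i) = unit_vec (2 * n) (n + i)"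
      using assms i by (auto simp: SL2_power_on_def e_vec_def f_vec_def)
    then show ?thesis
      using col[of i i] col[of i "n + i"] col[of "n + i" i] col[of "n + i" "n + i"] i
      by (simp add: g index_block_dmat)
  qed
  then show ?thesis using that g det by blast
qed

text \<open>Because \<open>I\<close> and \<open>J\<close> are disjoint, the index set
  \<open>T\<close> contains neither \<open>e_i\<close> nor \<open>f_i\<close> for
  \<open>i \<in> I\<close>, and both for \<open>i \<in> J\<close>. Column \<open>T\<close> of the
  compound matrix then shows that the basis vector is fixed, and row \<open>T\<close> that the
  coordinate function at \<open>T\<close> is fixed.\<close>

lemma ext_act_minor_vec:
  assumes g: "g \<in> SL2_power_on n (I \<union> J)" and IJ: "(I, J) \<in> E_indices n k"
  shows "ext_act (2 * n) n g (minor_vec n I J) = minor_vec n I J"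
    and "ext_act (2 * n) n g x (ef_set n ({0..<n} - I) J) = x (ef_set n ({0..<n} - I) J)"
proof -
  obtain a b c d where g_eq: "g = block_dmat n a b c d"
    and det: "\<And>i. i < n \<Longrightarrow> a i * d i - b i * c i = 1"
    and triv: "\<And>i. i < n \<Longrightarrow> i \<notin> I \<union> J \<Longrightarrow> a i = 1 \<and> b i = 0 \<and> c i = 0 \<and> d i = 1"
    using g by (rule SL2_power_onE) blast
  have IJ': "I \<subseteq> {0..<n}" "J \<subseteq> {0..<n}" "card I = card J" "I \<inter> J = {}"
    using IJ by (auto simp: E_indices_def)
  define T where "T = ef_set n ({0..<n} - I) J"
  have "card ({0..<n} - I) + card J = n"
    using IJ' card_mono[of "{0..<n}" I] by (simp add: card_Diff_subset finite_subset)
  then have T: "T \<in> ksubsets (2 * n) n"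
    unfolding T_def using IJ' by (intro ef_set_ksubsets) auto
  have full: "i \<in> T \<longleftrightarrow> n + i \<in> T" if "i < n" "i \<in> I \<union> J" for i
    using that IJ' by (auto simp: T_def ef_set_def)
  have g_carrier: "g \<in> carrier_mat (2 * n) (2 * n)" by (simp add: g_eq)
  have left: "det (select_mat g (sorted_list_of_set U) (sorted_list_of_set T)) = (if U = T then 1 else 0)"
    if "U \<in> ksubsets (2 * n) n" for U
    unfolding g_eq using det triv T full that by (rule det_select_block_dmat_fixed)
  \<comment> \<open>Transposition exchanges \<open>b\<close> and \<open>c\<close> and keeps the
    determinant conditions, so the statement about columns also gives the one about rows.\<close>
  have right: "det (select_mat g (sorted_list_of_set T) (sorted_list_of_set U)) = (if U = T then 1 else 0)"
    if U: "U \<in> ksubsets (2 * n) n" for U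
  proof -
    have "det (select_mat g (sorted_list_of_set T) (sorted_list_of_set U)) =
        det (select_mat (transpose_mat g) (sorted_list_of_set U) (sorted_list_of_set T))"
      using ksubsetsD[OF T] ksubsetsD[OF U] by (simp add: det_select_mat_transpose g_eq)
    also have "\<dots> = (if U = T then 1 else 0)"
      unfolding g_eq transpose_block_dmat
    proof (rule det_select_block_dmat_fixed[OF _ _ T full U])
      show "a i * d i - c i * b i = 1" if "i < n" for i using det[OF that] by (simp add: mult.commute)
      show "a i = 1 \<and> c i = 0 \<and> b i = 0 \<and> d i = 1" if "i < n" "i \<notin> I \<union> J" for i
        using triv[OF that] by simp
    qed
    finally show ?thesis .
  qed
  show "ext_act (2 * n) n g (minor_vec n I J) = minor_vec n I J"
  proof
    fix U
    have mv: "minor_vec n I J = (\<lambda>W. if W = T then 1 else 0)"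
      unfolding T_def using IJ' by (intro minor_vec_eq)
    show "ext_act (2 * n) n g (minor_vec n I J) U = minor_vec n I J U"
    proof (cases "U \<in> ksubsets (2 * n) n")
      case True
      have "ext_act (2 * n) n g (minor_vec n I J) U =
          (\<Sum>W\<in>ksubsets (2 * n) n. if W = T then (if U = T then 1 else 0) else 0)"
        unfolding ext_act_eq[OF g_carrier True] mv
        by (intro sum.cong) (auto simp: left True T)
      then show ?thesis using T by (simp add: mv)
    next
      case False
      then show ?thesis using T by (auto simp: ext_act_outside mv)
    qed
  qed
  have "ext_act (2 * n) n g x T = (\<Sum>W\<in>ksubsets (2 * n) n. if W = T then x W else 0)"
    unfolding ext_act_eq[OF g_carrier T] by (intro sum.cong) (auto simp: right)
  then show "ext_act (2 * n) n g x (ef_set n ({0..<n} - I) J) = x (ef_set n ({0..<n} - I) J)"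
    using T by (simp add: T_def)
qed

text \<open>The coordinate at the E-minor is unchanged by \<open>g\<close>, and the sign between
  coordinate and minor is the same for \<open>A\<close> and \<open>B\<close>. Only the projective
  factor \<open>c\<close> remains.\<close>

lemma minor_eq_of_ext_act:
  assumes g: "g \<in> SL2_power_on n (I \<union> J)" and IJ: "(I, J) \<in> E_indices n k"
    and A: "A \<in> carrier_mat n n" and B: "B \<in> carrier_mat n n"
    and eq: "ext_act (2 * n) n g (minors_of n A) = (\<lambda>T. c * minors_of n B T)"
  shows "c * minor B I J = minor A I J"
proof -
  let ?R = "{0..<n} - I"
  have IJ': "I \<subseteq> {0..<n}" "J \<subseteq> {0..<n}" "card I = card J" using IJ by (auto simp: E_indices_def)
  then have "card ?R + card J = n" and I: "{0..<n} - ?R = I"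
    using card_mono[of "{0..<n}" I] by (auto simp: card_Diff_subset finite_subset)
  then obtain s where s: "s \<noteq> 0"
    "\<And>A. A \<in> carrier_mat n n \<Longrightarrow> minors_of n A (ef_set n ?R J) = s * minor A ({0..<n} - ?R) J"
    using IJ' by (elim minors_of_ef_set[of ?R n J, rotated 3]) auto
  have "minors_of n A (ef_set n ?R J) = c * minors_of n B (ef_set n ?R J)"
    using ext_act_minor_vec(2)[OF g IJ, of "minors_of n A"] eq by simp
  then show ?thesis using s A B I by (simp add: mult.left_commute)
qed

section \<open>Preservation of the number of full pairs\<close>

text \<open>Both \<open>i\<close> and \<open>n + i\<close> reduce to \<open>i\<close> modulo
  \<open>n\<close>, so \<open>g\<close> maps the span of \<open>e_i, f_i\<close> into the span of
  the pair with index \<open>\<sigma> i\<close>. This common property of the two factors of the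
  group survives products.\<close>

definition mixes :: "nat \<Rightarrow> (nat \<Rightarrow> nat) \<Rightarrow> complex mat \<Rightarrow> bool" where
  "mixes n \<sigma> g \<longleftrightarrow> g \<in> carrier_mat (2 * n) (2 * n) \<and>
     (\<forall>a < 2 * n. \<forall>b < 2 * n. g $$ (a, b) \<noteq> 0 \<longrightarrow> a mod n = \<sigma> (b mod n))"

lemma mixes_mult:
  assumes g: "mixes n \<sigma> g" and h: "mixes n \<tau> h"
  shows "mixes n (\<sigma> \<circ> \<tau>) (g * h)"
  unfolding mixes_def
proof (intro conjI allI impI)
  have car: "g \<in> carrier_mat (2 * n) (2 * n)" "h \<in> carrier_mat (2 * n) (2 * n)"
    using g h by (simp_all add: mixes_def)
  then show "g * h \<in> carrier_mat (2 * n) (2 * n)" by simp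
  fix a b assume ab: "a < 2 * n" "b < 2 * n" "(g * h) $$ (a, b) \<noteq> 0"
  then have "(\<Sum>k = 0..<2 * n. g $$ (a, k) * h $$ (k, b)) \<noteq> 0"
    using car by (simp add: scalar_prod_def)
  then obtain k where "k < 2 * n" "g $$ (a, k) \<noteq> 0" "h $$ (k, b) \<noteq> 0"
    by (auto elim!: sum.not_neutral_contains_not_neutral)
  then show "a mod n = (\<sigma> \<circ> \<tau>) (b mod n)" using g h ab by (simp add: mixes_def)
qed

lemma mixes_block_dmat: "mixes n id (block_dmat n a b c d)"
  by (auto simp: mixes_def index_block_dmat mod_add_self1 split: if_splits)

text \<open>By injectivity of \<open>\<sigma>\<close>, the two members of a full pair of
  \<open>T\<close> go to distinct elements of \<open>U\<close> with the same residue, and these make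
  up a full pair of \<open>U\<close>. Applying \<open>\<sigma>\<close> to its index recovers the
  original pair.\<close>

lemma card_pairs_in_le:
  assumes \<sigma>: "inj_on \<sigma> {0..<n}"
    and f: "bij_betw f T U" "\<And>t. t \<in> T \<Longrightarrow> t mod n = \<sigma> (f t mod n)"
    and U: "U \<subseteq> {..<2 * n}"
  shows "card (pairs_in n T) \<le> card (pairs_in n U)"
proof (rule card_inj_on_le)
  show "inj_on (\<lambda>i. f i mod n) (pairs_in n T)"
  proof (rule inj_onI)
    fix i j assume ij: "i \<in> pairs_in n T" "j \<in> pairs_in n T" "f i mod n = f j mod n"
    then have "i mod n = j mod n" using f(2)[of i] f(2)[of j] by (simp add: pairs_in_def)
    then show "i = j" using ij by (simp add: pairs_in_def)
  qed
  show "(\<lambda>i. f i mod n) ` pairs_in n T \<subseteq> pairs_in n U"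
  proof (rule image_subsetI)
    fix i assume i: "i \<in> pairs_in n T"
    then have n: "n > 0" and iT: "i \<in> T" "n + i \<in> T" by (auto simp: pairs_in_def)
    define u v where "u = f i" and "v = f (n + i)"
    have uv: "u \<in> U" "v \<in> U" "u < 2 * n" "v < 2 * n"
      using f(1) iT U by (auto simp: u_def v_def dest: bij_betwE)
    have "u \<noteq> v" using f(1) iT n by (auto simp: u_def v_def bij_betw_def inj_on_eq_iff)
    moreover have "u mod n = v mod n"
    proof -
      have "\<sigma> (u mod n) = \<sigma> (v mod n)"
        using f(2)[OF iT(1)] f(2)[OF iT(2)] by (simp add: u_def v_def)
      then show ?thesis using \<sigma> n by (auto simp: inj_on_def)
    qed
    \<comment> \<open>A residue class has just two members below \<open>2 * n\<close>, so the
      distinct \<open>u\<close> and \<open>v\<close> exhaust it.\<close>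
    moreover have "w = w mod n \<or> w = n + w mod n" if "w < 2 * n" for w
    proof (cases "w < n")
      case False
      then have "w mod n = w - n" using that by (simp add: le_mod_geq)
      then show ?thesis using False by simp
    qed simp
    ultimately have "{u, v} = {u mod n, n + u mod n}" using uv by (metis insert_commute)
    then have "{u mod n, n + u mod n} \<subseteq> U" using uv(1,2) by (metis empty_subsetI insert_subset)
    then have "u mod n \<in> U" "n + u mod n \<in> U" by simp_all
    then show "f i mod n \<in> pairs_in n U" using n by (simp add: pairs_in_def u_def)
  qed
  show "finite (pairs_in n U)" by (simp add: pairs_in_def)
qed

text \<open>A nonzero minor on \<open>T\<close> and \<open>U\<close> forces \<open>U\<close> to have
  at least as many full pairs as \<open>T\<close>, hence at least \<open>k\<close>, and there
  \<open>x\<close> vanishes.\<close>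

lemma ext_act_preserves_vanishing:
  assumes g: "mixes n \<sigma> g" and \<sigma>: "\<sigma> permutes {0..<n}"
    and x: "\<And>T. T \<in> ksubsets (2 * n) m \<Longrightarrow> k \<le> card (pairs_in n T) \<Longrightarrow> x T = 0"
    and T: "T \<in> ksubsets (2 * n) m" "k \<le> card (pairs_in n T)"
  shows "ext_act (2 * n) m g x T = 0"
proof -
  have car: "g \<in> carrier_mat (2 * n) (2 * n)" using g by (simp add: mixes_def)
  have "x U * det (select_mat g (sorted_list_of_set T) (sorted_list_of_set U)) = 0"
    if U: "U \<in> ksubsets (2 * n) m" for U
  proof (rule ccontr)
    assume *: "x U * det (select_mat g (sorted_list_of_set T) (sorted_list_of_set U)) \<noteq> 0"
    then have nz: "det (select_mat g (sorted_list_of_set T) (sorted_list_of_set U)) \<noteq> 0" by simp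
    obtain f where f: "bij_betw f T U" "\<And>t. t \<in> T \<Longrightarrow> g $$ (t, f t) \<noteq> 0"
      using bij_of_det_select_mat_nonzero[OF nz] ksubsetsD[OF T(1)] ksubsetsD[OF U] by auto
    have "t mod n = \<sigma> (f t mod n)" if t: "t \<in> T" for t
    proof -
      have "f t \<in> U" using f(1) t by (auto dest: bij_betwE)
      then have "t < 2 * n" "f t < 2 * n" using t ksubsetsD[OF T(1)] ksubsetsD[OF U] by auto
      then show ?thesis using g f(2)[OF t] by (simp add: mixes_def)
    qed
    then have "card (pairs_in n T) \<le> card (pairs_in n U)"
      using permutes_inj_on[OF \<sigma>] f(1) ksubsetsD[OF U] by (intro card_pairs_in_le) auto
    then have "x U = 0" using x[OF U] T(2) by simp
    then show False using * by simp
  qed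
  then show ?thesis unfolding ext_act_eq[OF car T(1)] by (simp add: sum.neutral)
qed

section \<open>Inverses in the group and invariance of the E-rank\<close>

lemma SL2_power_left_inverse:
  assumes "g \<in> SL2_power n"
  obtains g' where "mixes n id g" "mixes n id g'" "g' * g = 1\<^sub>m (2 * n)"
proof -
  obtain a b c d where g: "g = block_dmat n a b c d"
    and det: "\<And>i. i < n \<Longrightarrow> a i * d i - b i * c i = 1"
    using assms by (rule SL2_powerE) blast
  \<comment> \<open>The inverse in each copy is the adjugate of a 2 by 2 matrix of determinant
    1.\<close>
  have "block_dmat n d (\<lambda>i. - b i) (\<lambda>i. - c i) a * g = block_dmat n (\<lambda>_. 1) (\<lambda>_. 0) (\<lambda>_. 0) (\<lambda>_. 1)"
    unfolding g block_dmat_mult using det by (intro block_dmat_cong) (auto simp: algebra_simps)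
  then show ?thesis
    using that[of "block_dmat n d (\<lambda>i. - b i) (\<lambda>i. - c i) a"] by (simp add: g mixes_block_dmat block_dmat_one)
qed

lemma perm_mat_carrier [simp]: "perm_mat n \<sigma> \<in> carrier_mat n n"
  by (simp add: perm_mat_def)

lemma perm_mat_mult_inv:
  assumes "\<sigma> permutes {0..<n}"
  shows "perm_mat n (inv_into UNIV \<sigma>) * perm_mat n \<sigma> = 1\<^sub>m n"
proof (rule eq_matI)
  fix i j assume "i < dim_row (1\<^sub>m n)" "j < dim_col (1\<^sub>m n)"
  then have ij: "i < n" "j < n" by simp_all
  have sj: "\<sigma> j < n" using permutes_in_image[OF assms, of j] ij by simp
  have "(perm_mat n (inv_into UNIV \<sigma>) * perm_mat n \<sigma>) $$ (i, j) =
      (\<Sum>k = 0..<n. (if i = inv_into UNIV \<sigma> k then 1 else 0) * (if k = \<sigma> j then 1 else 0))"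
    using ij by (auto simp: perm_mat_def scalar_prod_def intro!: sum.cong)
  also have "\<dots> = (\<Sum>k = 0..<n. if k = \<sigma> j then (if i = inv_into UNIV \<sigma> (\<sigma> j) then 1 else 0) else 0)"
    by (intro sum.cong) auto
  also have "\<dots> = 1\<^sub>m n $$ (i, j)"
    using ij sj by (simp add: permutes_inverses[OF assms])
  finally show "(perm_mat n (inv_into UNIV \<sigma>) * perm_mat n \<sigma>) $$ (i, j) = 1\<^sub>m n $$ (i, j)" .
qed (simp_all add: perm_mat_def)

lemma mixes_perm:
  "mixes n \<sigma> (four_block_mat (perm_mat n \<sigma>) (0\<^sub>m n n) (0\<^sub>m n n) (perm_mat n \<sigma>))"
  unfolding mixes_def
proof (intro conjI allI impI)
  show "four_block_mat (perm_mat n \<sigma>) (0\<^sub>m n n) (0\<^sub>m n n) (perm_mat n \<sigma>) \<in> carrier_mat (2 * n) (2 * n)"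
    by (rule carrier_matI) (simp_all add: perm_mat_def)
  fix a b assume ab: "a < 2 * n" "b < 2 * n"
    and nz: "four_block_mat (perm_mat n \<sigma>) (0\<^sub>m n n) (0\<^sub>m n n) (perm_mat n \<sigma>) $$ (a, b) \<noteq> 0"
  have "w mod n = (if w < n then w else w - n)" if "w < 2 * n" for w
    using that by (simp add: le_mod_geq)
  then show "a mod n = \<sigma> (b mod n)"
    using ab nz by (auto simp: perm_mat_def split: if_splits)
qed

text \<open>For \<open>g = s * h\<close> the inverse is \<open>h' * s'\<close>. The factors
  \<open>s\<close> and \<open>s'\<close> keep every pair index, so the permutations of the pairs
  come from \<open>h\<close> and \<open>h'\<close>.\<close>

lemma G_group_left_inverse:
  assumes "g \<in> G_group n"
  obtains \<sigma> g' where "\<sigma> permutes {0..<n}" "mixes n \<sigma> g" "mixes n (inv_into UNIV \<sigma>) g'" "g' * g = 1\<^sub>m (2 * n)"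
proof -
  obtain s h where g: "g = s * h" and s: "s \<in> SL2_power n" and "h \<in> Sym_group n"
    using assms by (auto simp: G_group_def)
  then obtain \<sigma> where \<sigma>: "\<sigma> permutes {0..<n}"
    and h: "h = four_block_mat (perm_mat n \<sigma>) (0\<^sub>m n n) (0\<^sub>m n n) (perm_mat n \<sigma>)"
    by (auto simp: Sym_group_def)
  obtain s' where s': "mixes n id s" "mixes n id s'" "s' * s = 1\<^sub>m (2 * n)"
    using s by (rule SL2_power_left_inverse)
  define h' where "h' = four_block_mat (perm_mat n (inv_into UNIV \<sigma>)) (0\<^sub>m n n) (0\<^sub>m n n) (perm_mat n (inv_into UNIV \<sigma>))"
  have mh: "mixes n \<sigma> h" "mixes n (inv_into UNIV \<sigma>) h'" unfolding h h'_def by (rule mixes_perm)+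
  have hh: "h' * h = 1\<^sub>m (2 * n)"
  proof -
    have zero: "perm_mat n \<tau> * 0\<^sub>m n n = 0\<^sub>m n n" "0\<^sub>m n n * perm_mat n \<tau> = 0\<^sub>m n n" for \<tau>
      by (rule right_mult_zero_mat left_mult_zero_mat, simp)+
    have "h' * h = four_block_mat (1\<^sub>m n) (0\<^sub>m n n) (0\<^sub>m n n) (1\<^sub>m n)"
      unfolding h h'_def
      by (subst mult_four_block_mat[where ?nr1.0 = n and ?n1.0 = n and ?n2.0 = n
        and ?nr2.0 = n and ?nc1.0 = n and ?nc2.0 = n]) 
        (simp_all add: perm_mat_mult_inv[OF \<sigma>] zero)
    also have "\<dots> = 1\<^sub>m (2 * n)" by (simp add: four_block_one_mat mult_2)
    finally show ?thesis .
  qed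
  have car: "s \<in> carrier_mat (2 * n) (2 * n)" "s' \<in> carrier_mat (2 * n) (2 * n)"
    "h \<in> carrier_mat (2 * n) (2 * n)" "h' \<in> carrier_mat (2 * n) (2 * n)"
    using s' mh by (simp_all add: mixes_def)
  have "h' * s' * g = h' * (s' * s * h)"
    unfolding g using car by (simp add: assoc_mult_mat[where ?n\<^sub>2 = "2 * n" and ?n\<^sub>3 = "2 * n" and ?n\<^sub>4 = "2 * n" and ?n\<^sub>1 = "2 * n"])
  also have "\<dots> = 1\<^sub>m (2 * n)" using s'(3) hh car by simp
  finally have "h' * s' * g = 1\<^sub>m (2 * n)" .
  moreover have "mixes n \<sigma> g" using mixes_mult[OF s'(1) mh(1)] by (simp add: g)
  moreover have "mixes n (inv_into UNIV \<sigma>) (h' * s')" using mixes_mult[OF mh(2) s'(2)] by simp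
  ultimately show ?thesis using that \<sigma> by blast
qed

text \<open>For every \<open>k\<close>, the vanishing of all E-minors of size \<open>k\<close>
  passes from \<open>A\<close> to \<open>B\<close> by \<open>g\<close>, using
  \<open>c \<noteq> 0\<close>, and back by \<open>g'\<close>. The conditions that define the two
  least values therefore coincide.\<close>

lemma E_rank_invariant:
  assumes g: "g \<in> G_group n" and mv: "moves n g A B"
  shows "E_rank B = E_rank A"
proof -
  obtain \<sigma> g' where \<sigma>: "\<sigma> permutes {0..<n}" and mix: "mixes n \<sigma> g" "mixes n (inv_into UNIV \<sigma>) g'"
    and left_inv: "g' * g = 1\<^sub>m (2 * n)"
    using g by (rule G_group_left_inverse)
  obtain c where A: "A \<in> carrier_mat n n" and B: "B \<in> carrier_mat n n" and c: "c \<noteq> 0"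
    and eq: "ext_act (2 * n) n g (minors_of n A) = (\<lambda>T. c * minors_of n B T)"
    using mv by (auto simp: moves_def)
  have "ext_act (2 * n) n g' (\<lambda>T. c * minors_of n B T) = ext_act (2 * n) n (g' * g) (minors_of n A)"
    using mix by (simp add: ext_act_mult eq mixes_def)
  also have "\<dots> = minors_of n A"
    unfolding left_inv by (rule ext_act_one) (rule minors_of_outside)
  finally have eq': "minors_of n A = ext_act (2 * n) n g' (\<lambda>T. c * minors_of n B T)" by simp
  have "(\<forall>(I, J) \<in> E_indices n k. minor B I J = 0) \<longleftrightarrow> (\<forall>(I, J) \<in> E_indices n k. minor A I J = 0)" for k
    unfolding E_minors_vanish_iff[OF A] E_minors_vanish_iff[OF B]
  proof (intro iffI ballI impI)
    fix T assume "\<forall>T\<in>ksubsets (2 * n) n. k \<le> card (pairs_in n T) \<longrightarrow> minors_of n B T = 0"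
      and "T \<in> ksubsets (2 * n) n" "k \<le> card (pairs_in n T)"
    then show "minors_of n A T = 0"
      unfolding eq' by (intro ext_act_preserves_vanishing[OF mix(2) permutes_inv[OF \<sigma>]]) auto
  next
    fix T assume "\<forall>T\<in>ksubsets (2 * n) n. k \<le> card (pairs_in n T) \<longrightarrow> minors_of n A T = 0"
      and "T \<in> ksubsets (2 * n) n" "k \<le> card (pairs_in n T)"
    then have "ext_act (2 * n) n g (minors_of n A) T = 0"
      by (intro ext_act_preserves_vanishing[OF mix(1) \<sigma>]) auto
    then show "minors_of n B T = 0" using c by (simp add: eq)
  qed
  then show ?thesis using A B by (simp add: E_rank_def)
qed

theorem proposition4p1:
  fixes n :: nat
  shows
    "(\<forall>k. \<forall>(I, J) \<in> E_indices n k.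
        (\<forall>g \<in> SL2_power_on n (I \<union> J).
           ext_act (2 * n) n g (minor_vec n I J) = minor_vec n I J \<and>
           (\<forall>A \<in> carrier_mat n n. \<forall>B \<in> carrier_mat n n. \<forall>c.
              ext_act (2 * n) n g (minors_of n A) = (\<lambda>T. c * minors_of n B T)
                \<longrightarrow> c * minor B I J = minor A I J)) \<and>
        (I \<union> J = {0..<n} \<longrightarrow>
          (\<forall>g \<in> SL2_power n. ext_act (2 * n) n g (minor_vec n I J) = minor_vec n I J)))
     \<and> (\<forall>g \<in> G_group n. \<forall>A B. moves n g A B \<longrightarrow> E_rank B = E_rank A)"
proof (intro conjI allI ballI impI)
  fix k and p :: "nat set \<times> nat set"
  assume "p \<in> E_indices n k"
  then obtain I J where p: "p = (I, J)" and IJ: "(I, J) \<in> E_indices n k" by (cases p) auto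
  \<comment> \<open>With \<open>I \<union> J = {0..<n}\<close> no copy is required to act trivially,
    so the claim about the whole group is a case of the one about
    \<open>SL2_power_on\<close>.\<close>
  have "SL2_power n = SL2_power_on n {0..<n}" by (auto simp: SL2_power_on_def)
  then show "case p of (I, J) \<Rightarrow>
        (\<forall>g \<in> SL2_power_on n (I \<union> J).
           ext_act (2 * n) n g (minor_vec n I J) = minor_vec n I J \<and>
           (\<forall>A \<in> carrier_mat n n. \<forall>B \<in> carrier_mat n n. \<forall>c.
              ext_act (2 * n) n g (minors_of n A) = (\<lambda>T. c * minors_of n B T)
                \<longrightarrow> c * minor B I J = minor A I J)) \<and>
        (I \<union> J = {0..<n} \<longrightarrow>
          (\<forall>g \<in> SL2_power n. ext_act (2 * n) n g (minor_vec n I J) = minor_vec n I J))"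
    unfolding p using ext_act_minor_vec(1)[OF _ IJ] minor_eq_of_ext_act[OF _ IJ] by auto
qed (rule E_rank_invariant)

end
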